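(* Let $(G,c)$ be a transient resistance network. Then $R^{\mathrm{tr}}(a,b)=R^F(a,b)$ for all vertices $a,b$ of $G$.
   Context: A resistance network $(G,c)$ is a connected graph with vertex set $G^0$ and a conductance function $c:G^0\times G^0\to[0,\infty)$ with $c_{xy}=c_{yx}$, $c_{xx}=0$, where $x\sim y$ iff $c_{xy}>0$, and $c(x):=\sum_{y\sim x}c_{xy}<\infty$ for every vertex $x$ (vertices of infinite degree are allowed). Connected means that any two vertices are joined by a finite path of edges. The random walk on $G$ has transition probabilities $p(x,y)=c_{xy}/c(x)$, with transition operator $\mathbb{P}$; the network is transient if this random walk is transient. The Laplacian is $(\Delta v)(x)=\sum_{y\sim x}c_{xy}(v(x)-v(y))$, so $\Delta=c(\mathbb{I}-\mathbb{P})$. On a finite network $H$, the effective resistance is $R_H(x,y)=v(x)-v(y)$, where $v$ is any solution of $\Delta v=\delta_x-\delta_y$ on $H$ ($\delta_x$ is the indicator function of $\{x\}$). An exhaustion $\{G_k\}$ of $G$ is an increasing sequence of finite connected full subgraphs with union $G$ (full: containing all edges of $G$ between its vertices, with the same conductances); $G_k^F$ denotes this full subnetwork. The free resistance is $R^F(a,b):=\lim_{k\to\infty}R_{G_k^F}(a,b)$. For a nonempty set of vertices $H^0\subseteq G^0$, write $\Delta$ in block form $\begin{bmatrix} A & B^T \\ B & D \end{bmatrix}$ with respect to $H^0$ and its complement. The trace of $\Delta$ to $H^0$ is the Schur complement $\operatorname{tr}(\Delta,H^0):=A-B^TD^{-1}B$, where $D^{-1}=\big(\sum_{n=0}^\infty\mathbb{P}_D^n\big)c_D^{-1}$,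 with $\mathbb{P}_D$ the block of $\mathbb{P}$ on the complement of $H^0$ and $c_D$ the diagonal matrix of the $c(x)$, $x\notin H^0$ (the series converges entrywise). The trace network $H^{\mathrm{tr}}$ is the network with vertex set $H^0$ whose conductances $c^{\mathrm{tr}}_{xy}$, $x\ne y$, are the negatives of the off-diagonal entries of $\operatorname{tr}(\Delta,H^0)$. The trace resistance is $R^{\mathrm{tr}}(a,b):=\lim_{k\to\infty}R_{G_k^{\mathrm{tr}}}(a,b)$, where $\{G_k\}$ is any exhaustion of $G$ with $a,b\in G_k$ for all $k$, and $R_{G_k^{\mathrm{tr}}}$ is the effective resistance of the finite network $G_k^{\mathrm{tr}}$. *)

theory Defs
  imports "HOL-Probability.Probability"
begin

text \<open>
  A network is given by a vertex set \<open>V\<close> and a conductance function \<open>c\<close>, of which only the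
  values on \<open>V \<times> V\<close> matter.  Hence the full subnetwork on \<open>W \<subseteq> V\<close> is given by \<open>W\<close> and
  the same \<open>c\<close>.  Two vertices \<open>x\<close>, \<open>y\<close> are adjacent iff \<open>c x y > 0\<close>, so that sums over
  the neighbours of a vertex may be written as sums over \<open>V\<close>.
\<close>

definition edge_rel :: "'a set \<Rightarrow> ('a \<Rightarrow> 'a \<Rightarrow> real) \<Rightarrow> ('a \<times> 'a) set" where
  "edge_rel V c = {(x, y). x \<in> V \<and> y \<in> V \<and> c x y > 0}"

definition connected_network :: "'a set \<Rightarrow> ('a \<Rightarrow> 'a \<Rightarrow> real) \<Rightarrow> bool" where
  "connected_network V c \<longleftrightarrow> V \<noteq> {} \<and> (\<forall>x\<in>V. \<forall>y\<in>V. (x, y) \<in> (edge_rel V c)\<^sup>*)"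

definition resistance_network :: "'a set \<Rightarrow> ('a \<Rightarrow> 'a \<Rightarrow> real) \<Rightarrow> bool" where
  "resistance_network V c \<longleftrightarrow>
     (\<forall>x\<in>V. \<forall>y\<in>V. 0 \<le> c x y \<and> c x y = c y x) \<and>
     (\<forall>x\<in>V. c x x = 0) \<and>
     (\<forall>x\<in>V. c x summable_on V) \<and>
     connected_network V c"

definition total_cond :: "'a set \<Rightarrow> ('a \<Rightarrow> 'a \<Rightarrow> real) \<Rightarrow> 'a \<Rightarrow> real" where
  "total_cond V c x = (\<Sum>\<^sub>\<infinity>y\<in>V. c x y)"

definition trans_prob :: "'a set \<Rightarrow> ('a \<Rightarrow> 'a \<Rightarrow> real) \<Rightarrow> 'a \<Rightarrow> 'a \<Rightarrow> real" where
  "trans_prob V c x y = c x y / total_cond V c x"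

definition laplacian :: "'a set \<Rightarrow> ('a \<Rightarrow> 'a \<Rightarrow> real) \<Rightarrow> ('a \<Rightarrow> real) \<Rightarrow> 'a \<Rightarrow> real" where
  "laplacian V c v x = (\<Sum>\<^sub>\<infinity>y\<in>V. c x y * (v x - v y))"

text \<open>
  \<open>walk_law V c x M\<close>: the measure \<open>M\<close> on the space of paths \<open>nat \<Rightarrow> V\<close> is the law of the
  random walk started at \<open>x\<close>.  It is determined by its values on cylinder sets.
\<close>

definition walk_law ::
  "'a set \<Rightarrow> ('a \<Rightarrow> 'a \<Rightarrow> real) \<Rightarrow> 'a \<Rightarrow> (nat \<Rightarrow> 'a) measure \<Rightarrow> bool" where
  "walk_law V c x M \<longleftrightarrow>
     prob_space M \<and>
     sets M = sets (Pi\<^sub>M UNIV (\<lambda>_. count_space V)) \<and>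
     (\<forall>n \<xi>. (\<forall>i\<le>n. \<xi> i \<in> V) \<longrightarrow>
        measure M {\<omega> \<in> space M. \<forall>i\<le>n. \<omega> i = \<xi> i} =
          (if \<xi> 0 = x then \<Prod>i<n. trans_prob V c (\<xi> i) (\<xi> (Suc i)) else 0))"

definition transient_network :: "'a set \<Rightarrow> ('a \<Rightarrow> 'a \<Rightarrow> real) \<Rightarrow> bool" where
  "transient_network V c \<longleftrightarrow>
     (\<forall>x\<in>V. \<exists>M. walk_law V c x M \<and>
        measure M {\<omega> \<in> space M. \<exists>n\<ge>1. \<omega> n = x} < 1)"

text \<open>On a finite connected network the value does not depend on the solution \<open>v\<close>.\<close>

definition eff_resistance :: "'a set \<Rightarrow> ('a \<Rightarrow> 'a \<Rightarrow> real) \<Rightarrow> 'a \<Rightarrow> 'a \<Rightarrow> real" where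
  "eff_resistance H c x y =
     (THE r. \<exists>v. (\<forall>z\<in>H. laplacian H c v z = indicator {x} z - indicator {y} z) \<and>
                 r = v x - v y)"

text \<open>Matrices are functions of two vertices; \<open>mat_prod W\<close> sums over the index set \<open>W\<close>.\<close>

definition mat_prod ::
  "'a set \<Rightarrow> ('a \<Rightarrow> 'a \<Rightarrow> real) \<Rightarrow> ('a \<Rightarrow> 'a \<Rightarrow> real) \<Rightarrow> 'a \<Rightarrow> 'a \<Rightarrow> real" where
  "mat_prod W A B x y = (\<Sum>\<^sub>\<infinity>z\<in>W. A x z * B z y)"

primrec mat_pow :: "'a set \<Rightarrow> ('a \<Rightarrow> 'a \<Rightarrow> real) \<Rightarrow> nat \<Rightarrow> 'a \<Rightarrow> 'a \<Rightarrow> real" where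
  "mat_pow W A 0 = (\<lambda>x y. if x = y then 1 else 0)"
| "mat_pow W A (Suc n) = mat_prod W A (mat_pow W A n)"

definition laplacian_entry :: "'a set \<Rightarrow> ('a \<Rightarrow> 'a \<Rightarrow> real) \<Rightarrow> 'a \<Rightarrow> 'a \<Rightarrow> real" where
  "laplacian_entry V c x y = laplacian V c (indicator {y}) x"

text \<open>
  \<open>D_inverse V c H\<close> is \<open>(\<Sum>n. P_D ^ n) c_D\<^sup>-\<^sup>1\<close>, where \<open>D\<close> is the block of the Laplacian on
  the complement \<open>V - H\<close>.
\<close>

definition D_inverse :: "'a set \<Rightarrow> ('a \<Rightarrow> 'a \<Rightarrow> real) \<Rightarrow> 'a set \<Rightarrow> 'a \<Rightarrow> 'a \<Rightarrow> real" where
  "D_inverse V c H x y = (\<Sum>n. mat_pow (V - H) (trans_prob V c) n x y) / total_cond V c y"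

text \<open>
  The Schur complement \<open>A - B\<^sup>T D\<^sup>-\<^sup>1 B\<close>.  All four blocks are restrictions of
  \<open>laplacian_entry V c\<close>; the index sets of the products single out the right ones when
  \<open>x, y \<in> H\<close>.
\<close>

definition laplacian_trace :: "'a set \<Rightarrow> ('a \<Rightarrow> 'a \<Rightarrow> real) \<Rightarrow> 'a set \<Rightarrow> 'a \<Rightarrow> 'a \<Rightarrow> real" where
  "laplacian_trace V c H x y =
     laplacian_entry V c x y -
     mat_prod (V - H) (laplacian_entry V c)
       (mat_prod (V - H) (D_inverse V c H) (laplacian_entry V c)) x y"

definition trace_cond :: "'a set \<Rightarrow> ('a \<Rightarrow> 'a \<Rightarrow> real) \<Rightarrow> 'a set \<Rightarrow> 'a \<Rightarrow> 'a \<Rightarrow> real" where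
  "trace_cond V c H x y = (if x = y then 0 else - laplacian_trace V c H x y)"

definition exhaustion :: "'a set \<Rightarrow> ('a \<Rightarrow> 'a \<Rightarrow> real) \<Rightarrow> (nat \<Rightarrow> 'a set) \<Rightarrow> bool" where
  "exhaustion V c G \<longleftrightarrow>
     (\<forall>k. finite (G k) \<and> connected_network (G k) c) \<and> incseq G \<and> (\<Union>k. G k) = V"

text \<open>
  \<open>R\<close> is the free (trace) resistance if it is the limit along every exhaustion.  Effective
  resistances in \<open>G k\<close> are meaningful only if both vertices lie in \<open>G k\<close>.
\<close>

definition has_free_resistance ::
  "'a set \<Rightarrow> ('a \<Rightarrow> 'a \<Rightarrow> real) \<Rightarrow> 'a \<Rightarrow> 'a \<Rightarrow> real \<Rightarrow> bool" where
  "has_free_resistance V c a b R \<longleftrightarrow>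
     (\<forall>G. exhaustion V c G \<and> (\<forall>k. a \<in> G k \<and> b \<in> G k) \<longrightarrow>
        (\<lambda>k. eff_resistance (G k) c a b) \<longlonglongrightarrow> R)"

definition has_trace_resistance ::
  "'a set \<Rightarrow> ('a \<Rightarrow> 'a \<Rightarrow> real) \<Rightarrow> 'a \<Rightarrow> 'a \<Rightarrow> real \<Rightarrow> bool" where
  "has_trace_resistance V c a b R \<longleftrightarrow>
     (\<forall>G. exhaustion V c G \<and> (\<forall>k. a \<in> G k \<and> b \<in> G k) \<longrightarrow>
        (\<lambda>k. eff_resistance (G k) (trace_cond V c (G k)) a b) \<longlonglongrightarrow> R)"

definition free_resistance :: "'a set \<Rightarrow> ('a \<Rightarrow> 'a \<Rightarrow> real) \<Rightarrow> 'a \<Rightarrow> 'a \<Rightarrow> real" where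
  "free_resistance V c a b = (THE R. has_free_resistance V c a b R)"

definition trace_resistance :: "'a set \<Rightarrow> ('a \<Rightarrow> 'a \<Rightarrow> real) \<Rightarrow> 'a \<Rightarrow> 'a \<Rightarrow> real" where
  "trace_resistance V c a b = (THE R. has_trace_resistance V c a b R)"

end

theory Submission imports Defs
begin

text \<open>
  Both resistances are the infimum \<open>R\<close> of the effective resistances between \<open>a\<close> and \<open>b\<close> in the
  finite connected full subnetworks that contain \<open>a\<close> and \<open>b\<close>.

  For the free resistance this is Rayleigh monotonicity: enlarging a subnetwork enlarges the energy
  of every function and hence lowers the resistance, and every finite subnetwork is swallowed by
  any exhaustion.

  For the trace resistance, let \<open>H\<close> be one of the sets of an exhaustion \<open>G\<close>.  The trace conductance
  of two vertices of \<open>H\<close> is their conductance plus the weight of all excursions from one to the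
  other through the complement of \<open>H\<close>.  Hence the trace conductances dominate the original ones, and
  Rayleigh monotonicity bounds the trace resistance above by the effective resistance of \<open>H\<close>, which
  tends to \<open>R\<close>.  It remains to see that every trace resistance is at least \<open>R\<close>
  (\<open>trace_resistance_ge\<close>).

  Consider only the excursions through the finite set \<open>F = G m - H\<close>.  Walks that leave \<open>H \<union> F\<close> are
  lost, and this loss only helps: eliminating the vertices of \<open>F\<close> does not increase the energy of any
  function (\<open>energy_trace_le\<close>).  The reason is a change of weights.  If \<open>\<phi> z\<close> denotes the probability
  that the walk from \<open>z\<close> reaches \<open>H\<close> before it is lost, then multiplying each conductance \<open>c z w\<close> by
  \<open>\<phi> z * \<phi> w \<le> 1\<close> gives a network without losses that has the same trace on \<open>H\<close>, and without losses
  the energy of the trace is a minimum over all extensions to \<open>F\<close>.  So the network formed by the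
  conductances of \<open>H\<close> and these excursions has resistance at least that of \<open>G m\<close>, hence at least \<open>R\<close>.
  As \<open>m\<close> grows, the excursion weights increase to those of the trace (\<open>trace_cond_limit\<close>, by
  monotone convergence in each of the nested infinite sums of the Schur complement), and the bound
  passes to the limit.

  Two facts have to be supplied on the way.  The Neumann series converges because from any vertex
  some path leads to \<open>H\<close> (\<open>green_bounded\<close>); applied to a finite network and \<open>H = {b}\<close>, this also
  yields the potential that defines the effective resistance.  And exhaustions exist
  (\<open>exhaustion_exists\<close>), because summability of the conductances at each vertex makes a connected
  network countable; otherwise the limits would not be determined.
\<close>

section \<open>Energy on finite vertex sets\<close>

definition dirichlet_form ::
  "'a set \<Rightarrow> ('a \<Rightarrow> 'a \<Rightarrow> real) \<Rightarrow> ('a \<Rightarrow> real) \<Rightarrow> ('a \<Rightarrow> real) \<Rightarrow> real" where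
  "dirichlet_form W c u v = (\<Sum>x\<in>W. \<Sum>y\<in>W. c x y * ((u x - u y) * (v x - v y))) / 2"

abbreviation energy :: "'a set \<Rightarrow> ('a \<Rightarrow> 'a \<Rightarrow> real) \<Rightarrow> ('a \<Rightarrow> real) \<Rightarrow> real" where
  "energy W c u \<equiv> dirichlet_form W c u u"

lemma dirichlet_form_commute: "dirichlet_form W c u v = dirichlet_form W c v u"
  by (simp add: dirichlet_form_def mult.commute)

lemma energy_mono:
  assumes "\<And>x y. x \<in> W \<Longrightarrow> y \<in> W \<Longrightarrow> x \<noteq> y \<Longrightarrow> c x y \<le> c' x y"
  shows "energy W c u \<le> energy W c' u"
  unfolding dirichlet_form_def
proof (intro divide_right_mono sum_mono)
  fix x y assume "x \<in> W" "y \<in> W"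
  then show "c x y * ((u x - u y) * (u x - u y)) \<le> c' x y * ((u x - u y) * (u x - u y))"
    by (cases "x = y") (auto intro!: mult_right_mono assms)
qed auto

lemma energy_scale: "energy W (\<lambda>x y. t * c x y) u = t * energy W c u"
  unfolding dirichlet_form_def by (simp add: sum_distrib_left mult.assoc)

lemma energy_mono_set:
  assumes "finite W'" "W \<subseteq> W'" "\<And>x y. x \<in> W' \<Longrightarrow> y \<in> W' \<Longrightarrow> 0 \<le> c x y"
  shows "energy W c u \<le> energy W' c u"
  unfolding dirichlet_form_def
proof (intro divide_right_mono)
  have "(\<Sum>x\<in>W. \<Sum>y\<in>W. c x y * ((u x - u y) * (u x - u y)))
      \<le> (\<Sum>x\<in>W. \<Sum>y\<in>W'. c x y * ((u x - u y) * (u x - u y)))"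
    using assms by (intro sum_mono sum_mono2) auto
  also have "\<dots> \<le> (\<Sum>x\<in>W'. \<Sum>y\<in>W'. c x y * ((u x - u y) * (u x - u y)))"
    using assms by (intro sum_mono2 sum_nonneg) auto
  finally show "(\<Sum>x\<in>W. \<Sum>y\<in>W. c x y * ((u x - u y) * (u x - u y)))
      \<le> (\<Sum>x\<in>W'. \<Sum>y\<in>W'. c x y * ((u x - u y) * (u x - u y)))" .
qed simp

lemma energy_nonneg:
  assumes "\<And>x y. x \<in> W \<Longrightarrow> y \<in> W \<Longrightarrow> 0 \<le> c x y"
  shows "0 \<le> energy W c u"
  unfolding dirichlet_form_def using assms by (intro divide_nonneg_nonneg sum_nonneg) auto

lemma dirichlet_form_Cauchy_Schwarz:
  assumes "finite W" "\<And>x y. x \<in> W \<Longrightarrow> y \<in> W \<Longrightarrow> 0 \<le> c x y"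
  shows "(dirichlet_form W c u v)\<^sup>2 \<le> energy W c u * energy W c v"
proof -
  define f where "f w = (\<lambda>(x, y). sqrt (c x y) * (w x - w y))" for w :: "'a \<Rightarrow> real"
  have *: "dirichlet_form W c w w' = (\<Sum>p\<in>W\<times>W. f w p * f w' p) / 2" for w w'
  proof -
    have "(\<Sum>p\<in>W\<times>W. f w p * f w' p) = (\<Sum>x\<in>W. \<Sum>y\<in>W. f w (x,y) * f w' (x,y))"
      by (simp add: sum.cartesian_product)
    also have "\<dots> = (\<Sum>x\<in>W. \<Sum>y\<in>W. c x y * ((w x - w y) * (w' x - w' y)))"
      using assms by (intro sum.cong refl) (auto simp: f_def algebra_simps simp flip: real_sqrt_mult)
    finally show ?thesis by (simp add: dirichlet_form_def)
  qed
  have "(\<Sum>p\<in>W\<times>W. f u p * f v p)\<^sup>2 \<le> (\<Sum>p\<in>W\<times>W. (f u p)\<^sup>2) * (\<Sum>p\<in>W\<times>W. (f v p)\<^sup>2)"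
    by (rule Cauchy_Schwarz_ineq_sum)
  then show ?thesis
    unfolding * by (simp add: power2_eq_square)
qed

text \<open>
  Summation by parts: average over the two orientations of each edge.
\<close>

lemma sum_mult_laplacian:
  assumes "finite W" and sym: "\<And>x y. x \<in> W \<Longrightarrow> y \<in> W \<Longrightarrow> c x y = c y x"
  shows "(\<Sum>x\<in>W. u x * laplacian W c v x) = dirichlet_form W c u v"
proof -
  define S where "S = (\<Sum>x\<in>W. \<Sum>y\<in>W. c x y * (u x * (v x - v y)))"
  have "(\<Sum>x\<in>W. u x * laplacian W c v x) = S"
    using assms(1) by (simp add: laplacian_def S_def sum_distrib_left algebra_simps)
  moreover have "S = (\<Sum>x\<in>W. \<Sum>y\<in>W. - (c x y * (u y * (v x - v y))))"
    unfolding S_def by (subst sum.swap) (auto intro!: sum.cong simp: sym algebra_simps)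
  then have "S + S = (\<Sum>x\<in>W. \<Sum>y\<in>W. c x y * ((u x - u y) * (v x - v y)))"
    by (subst (1) S_def, simp only: sum.distrib [symmetric])
       (auto intro!: sum.cong simp: algebra_simps)
  ultimately show ?thesis
    by (simp add: dirichlet_form_def)
qed

text \<open>
  Elimination of the vertices of \<open>F\<close> does not increase the energy, even if the walk is killed on \<open>F\<close>:
  the total conductance \<open>C z\<close> may exceed the sum of the conductances within \<open>H \<union> F\<close>.  By \<open>harm\<close>,
  \<open>\<pi> z y\<close> plays the role of the probability that the walk from \<open>z\<close> first meets \<open>H\<close> in \<open>y\<close>, so
  \<open>\<phi> z = (\<Sum>y\<in>H. \<pi> z y)\<close> is the probability of meeting \<open>H\<close> at all.

  Let \<open>L\<close> be the operator \<open>C - c\<close> on \<open>F\<close>; it is symmetric and positive semidefinite.  By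
  \<open>harm\<close>, \<open>L\<close> maps \<open>\<lambda>z. \<pi> z y\<close> to \<open>\<lambda>z. c z y\<close>.  With \<open>h z = (\<Sum>y\<in>H. \<pi> z y * u y)\<close> and
  \<open>\<sigma> z = (\<Sum>x\<in>H. c z x * (u x)\<^sup>2)\<close>, the energy gained on \<open>H\<close> is
  \<open>(\<Sum>z\<in>F. \<sigma> z * \<phi> z) - \<langle>h, L h\<rangle>\<close>.  The energy lost on \<open>F\<close>, with every conductance at \<open>z\<close> weighted by
  \<open>\<phi> z \<le> 1\<close> for each end point \<open>z\<close> in \<open>F\<close>, is
  \<open>(\<Sum>z\<in>F. \<sigma> z * \<phi> z) - 2 * \<langle>g, L h\<rangle> + \<langle>g, L g\<rangle>\<close> where \<open>g = \<phi> * u\<close>.  The difference of the two is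
  \<open>\<langle>g - h, L (g - h)\<rangle>\<close>.  Without the weights the identity would fail by a term of the wrong sign,
  since \<open>C\<close> also counts the conductance that is lost.
\<close>

lemma energy_trace_le:
  fixes c :: "'a \<Rightarrow> 'a \<Rightarrow> real" and \<pi> :: "'a \<Rightarrow> 'a \<Rightarrow> real"
  assumes fin: "finite H" "finite F" and disj: "H \<inter> F = {}"
    and c0: "\<And>x y. x \<in> H \<union> F \<Longrightarrow> y \<in> H \<union> F \<Longrightarrow> 0 \<le> c x y"
    and sym: "\<And>x y. x \<in> H \<union> F \<Longrightarrow> y \<in> H \<union> F \<Longrightarrow> c x y = c y x"
    and C: "\<And>z. z \<in> F \<Longrightarrow> (\<Sum>w\<in>F. c z w) \<le> C z"
    and \<pi>0: "\<And>z y. z \<in> F \<Longrightarrow> y \<in> H \<Longrightarrow> 0 \<le> \<pi> z y"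
    and \<pi>1: "\<And>z. z \<in> F \<Longrightarrow> (\<Sum>y\<in>H. \<pi> z y) \<le> 1"
    and harm: "\<And>z y. z \<in> F \<Longrightarrow> y \<in> H \<Longrightarrow> C z * \<pi> z y = c z y + (\<Sum>w\<in>F. c z w * \<pi> w y)"
  shows "energy H (\<lambda>x y. c x y + (\<Sum>z\<in>F. c x z * \<pi> z y)) u \<le> energy (H \<union> F) c u"
proof -
  define L where "L f z = C z * f z - (\<Sum>w\<in>F. c z w * f w)" for f :: "'a \<Rightarrow> real" and z
  define \<phi> where "\<phi> z = (\<Sum>y\<in>H. \<pi> z y)" for z
  define h where "h z = (\<Sum>y\<in>H. \<pi> z y * u y)" for z
  define s where "s z = (\<Sum>y\<in>H. \<pi> z y * (u y)\<^sup>2)" for z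
  define b where "b z = (\<Sum>x\<in>H. c z x)" for z
  define \<beta> where "\<beta> z = (\<Sum>x\<in>H. c z x * u x)" for z
  define \<sigma> where "\<sigma> z = (\<Sum>x\<in>H. c z x * (u x)\<^sup>2)" for z
  \<comment> \<open>the competitor for h in the minimisation of f |-> <f, L f> - 2 <f, beta>\<close>
  define g where "g z = \<phi> z * u z" for z
  have Lsum: "L (\<lambda>z. \<Sum>y\<in>H. \<pi> z y * e y) z = (\<Sum>y\<in>H. c z y * e y)" if "z \<in> F" for z and e :: "'a \<Rightarrow> real"
  proof -
    have "(\<Sum>w\<in>F. c z w * (\<Sum>y\<in>H. \<pi> w y * e y)) = (\<Sum>y\<in>H. (\<Sum>w\<in>F. c z w * \<pi> w y) * e y)"
      by (simp add: sum_distrib_left sum_distrib_right mult.assoc) (rule sum.swap)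
    moreover have "C z * (\<Sum>y\<in>H. \<pi> z y * e y) = (\<Sum>y\<in>H. (c z y + (\<Sum>w\<in>F. c z w * \<pi> w y)) * e y)"
      by (simp add: sum_distrib_left mult.assoc [symmetric] harm that)
    ultimately show ?thesis
      unfolding L_def by (simp add: sum_subtractf [symmetric] algebra_simps)
  qed
  have L\<phi>: "L \<phi> z = b z" and Lh: "L h z = \<beta> z" and Ls: "L s z = \<sigma> z" if "z \<in> F" for z
    using Lsum[OF that, of "\<lambda>_. 1"] Lsum[OF that, of u] Lsum[OF that, of "\<lambda>y. (u y)\<^sup>2"]
    by (simp_all add: \<phi>_def [abs_def] b_def h_def [abs_def] \<beta>_def s_def [abs_def] \<sigma>_def)
  have Lsym: "(\<Sum>z\<in>F. f z * L k z) = (\<Sum>z\<in>F. k z * L f z)" for f k :: "'a \<Rightarrow> real"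
  proof -
    have "(\<Sum>z\<in>F. \<Sum>w\<in>F. f z * (c z w * k w)) = (\<Sum>z\<in>F. \<Sum>w\<in>F. k z * (c z w * f w))"
      by (subst sum.swap) (auto intro!: sum.cong simp: sym)
    then show ?thesis
      by (simp add: L_def right_diff_distrib sum_subtractf sum_distrib_left mult_ac)
  qed
  have Lpos: "0 \<le> (\<Sum>z\<in>F. f z * L f z)" for f
  proof -
    have "(\<Sum>z\<in>F. \<Sum>w\<in>F. c z w * (f w)\<^sup>2) = (\<Sum>z\<in>F. \<Sum>w\<in>F. c z w * (f z)\<^sup>2)"
      by (subst sum.swap) (auto intro!: sum.cong simp: sym)
    moreover have "0 \<le> (\<Sum>z\<in>F. \<Sum>w\<in>F. c z w * (f z - f w)\<^sup>2)"
      using c0 by (intro sum_nonneg) auto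
    moreover have "(\<Sum>z\<in>F. \<Sum>w\<in>F. c z w * (f z - f w)\<^sup>2) =
      (\<Sum>z\<in>F. \<Sum>w\<in>F. c z w * (f z)\<^sup>2) + (\<Sum>z\<in>F. \<Sum>w\<in>F. c z w * (f w)\<^sup>2) - 2 * (\<Sum>z\<in>F. \<Sum>w\<in>F. c z w * (f z * f w))"
      by (simp add: power2_eq_square sum_distrib_left sum.distrib [symmetric] sum_subtractf [symmetric] algebra_simps)
    ultimately have "0 \<le> (\<Sum>z\<in>F. \<Sum>w\<in>F. c z w * (f z)\<^sup>2) - (\<Sum>z\<in>F. \<Sum>w\<in>F. c z w * (f z * f w))"
      by linarith
    also have "\<dots> = (\<Sum>z\<in>F. (\<Sum>w\<in>F. c z w) * (f z)\<^sup>2) - (\<Sum>z\<in>F. \<Sum>w\<in>F. c z w * (f z * f w))"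
      by (simp add: sum_distrib_right)
    also have "\<dots> \<le> (\<Sum>z\<in>F. C z * (f z)\<^sup>2) - (\<Sum>z\<in>F. \<Sum>w\<in>F. c z w * (f z * f w))"
      using C by (intro diff_right_mono sum_mono mult_right_mono) auto
    also have "\<dots> = (\<Sum>z\<in>F. f z * L f z)"
      by (simp add: L_def right_diff_distrib sum_subtractf sum_distrib_left power2_eq_square algebra_simps)
    finally show ?thesis .
  qed
  have Ldiff: "L (\<lambda>z. f z - k z) z = L f z - L k z" for f k z
    by (simp add: L_def right_diff_distrib sum_subtractf)
  have \<phi>01: "0 \<le> \<phi> z" "\<phi> z \<le> 1" if "z \<in> F" for z
    using that \<pi>0 \<pi>1 by (auto simp: \<phi>_def intro: sum_nonneg)
  \<comment> \<open>the energy gained on H, simplified by the symmetry of L\<close>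
  have "energy H (\<lambda>x y. c x y + (\<Sum>z\<in>F. c x z * \<pi> z y)) u =
      energy H c u + (\<Sum>x\<in>H. \<Sum>y\<in>H. \<Sum>z\<in>F. c x z * \<pi> z y * (u x - u y)\<^sup>2) / 2"
    by (simp add: dirichlet_form_def distrib_right sum.distrib add_divide_distrib sum_distrib_right power2_eq_square)
  also have "(\<Sum>x\<in>H. \<Sum>y\<in>H. \<Sum>z\<in>F. c x z * \<pi> z y * (u x - u y)\<^sup>2)
    = (\<Sum>z\<in>F. \<Sum>x\<in>H. \<Sum>y\<in>H. c z x * \<pi> z y * (u x - u y)\<^sup>2)"
    by (subst (2) sum.swap, subst sum.swap) (auto intro!: sum.cong simp: sym)
  also have "\<dots> = (\<Sum>z\<in>F. \<sigma> z * \<phi> z - 2 * (\<beta> z * h z) + b z * s z)"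
  proof (intro sum.cong refl)
    fix z
    have "(\<Sum>x\<in>H. \<Sum>y\<in>H. c z x * \<pi> z y * (u x - u y)\<^sup>2) =
      (\<Sum>x\<in>H. \<Sum>y\<in>H. (c z x * (u x)\<^sup>2) * \<pi> z y)
      - 2 * (\<Sum>x\<in>H. \<Sum>y\<in>H. (c z x * u x) * (\<pi> z y * u y))
      + (\<Sum>x\<in>H. \<Sum>y\<in>H. c z x * (\<pi> z y * (u y)\<^sup>2))"
      unfolding sum_distrib_left sum.distrib [symmetric] sum_subtractf [symmetric]
      by (intro sum.cong refl) (simp add: power2_eq_square algebra_simps)
    then show "(\<Sum>x\<in>H. \<Sum>y\<in>H. c z x * \<pi> z y * (u x - u y)\<^sup>2) =
        \<sigma> z * \<phi> z - 2 * (\<beta> z * h z) + b z * s z"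
      by (simp only: sum_product [symmetric] \<sigma>_def \<phi>_def \<beta>_def h_def b_def s_def)
  qed
  also have "\<dots> = 2 * (\<Sum>z\<in>F. \<sigma> z * \<phi> z) - 2 * (\<Sum>z\<in>F. h z * L h z)"
  proof -
    have "(\<Sum>z\<in>F. b z * s z) = (\<Sum>z\<in>F. \<sigma> z * \<phi> z)"
      using Lsym[of s \<phi>] by (simp add: L\<phi> Ls mult.commute)
    then show ?thesis
      by (simp add: sum.distrib sum_subtractf sum_distrib_left Lh mult.commute)
  qed
  also have "(2 * (\<Sum>z\<in>F. \<sigma> z * \<phi> z) - 2 * (\<Sum>z\<in>F. h z * L h z)) / 2 = (\<Sum>z\<in>F. \<sigma> z * \<phi> z) - (\<Sum>z\<in>F. h z * L h z)"
    by simp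
  \<comment> \<open>h minimises the quadratic functional: expand 0 <= <g - h, L (g - h)>\<close>
  also have "(\<Sum>z\<in>F. \<sigma> z * \<phi> z) - (\<Sum>z\<in>F. h z * L h z) \<le>
     (\<Sum>z\<in>F. \<sigma> z * \<phi> z) - 2 * (\<Sum>z\<in>F. g z * L h z) + (\<Sum>z\<in>F. g z * L g z)"
    using Lpos[of "\<lambda>z. g z - h z"] Lsym[of g h]
    by (simp add: Ldiff algebra_simps sum.distrib sum_subtractf)
  also have "\<dots> = (\<Sum>z\<in>F. \<phi> z * (\<sigma> z - 2 * (\<beta> z * u z) + b z * (u z)\<^sup>2)) +
      (\<Sum>z\<in>F. \<Sum>w\<in>F. c z w * (\<phi> z * \<phi> w) * (u z - u w)\<^sup>2) / 2"
  proof -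
    define X where "X = (\<Sum>z\<in>F. \<Sum>w\<in>F. c z w * (\<phi> z * \<phi> w) * (u z)\<^sup>2)"
    define Y where "Y = (\<Sum>z\<in>F. \<Sum>w\<in>F. c z w * (g z * g w))"
    have "(\<Sum>z\<in>F. \<Sum>w\<in>F. c z w * (\<phi> z * \<phi> w) * (u w)\<^sup>2) = X"
      unfolding X_def by (subst sum.swap) (auto intro!: sum.cong simp: sym)
    moreover have "(\<Sum>z\<in>F. \<Sum>w\<in>F. c z w * (\<phi> z * \<phi> w) * (u z - u w)\<^sup>2) =
       X + (\<Sum>z\<in>F. \<Sum>w\<in>F. c z w * (\<phi> z * \<phi> w) * (u w)\<^sup>2) - 2 * Y"
      unfolding X_def Y_def
      by (simp add: g_def power2_eq_square sum_distrib_left sum.distrib [symmetric] sum_subtractf [symmetric] algebra_simps)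
    ultimately have quad: "(\<Sum>z\<in>F. \<Sum>w\<in>F. c z w * (\<phi> z * \<phi> w) * (u z - u w)\<^sup>2) / 2 = X - Y"
      by simp
    have "(\<Sum>w\<in>F. c z w * (\<phi> z * \<phi> w) * (u z)\<^sup>2) = C z * (g z)\<^sup>2 - \<phi> z * (b z * (u z)\<^sup>2)"
      if "z \<in> F" for z
    proof -
      have "(\<Sum>w\<in>F. c z w * \<phi> w) = C z * \<phi> z - b z"
        using L\<phi>[OF that] by (simp add: L_def)
      moreover have "(\<Sum>w\<in>F. c z w * (\<phi> z * \<phi> w) * (u z)\<^sup>2) = (\<Sum>w\<in>F. c z w * \<phi> w) * \<phi> z * (u z)\<^sup>2"
        by (simp add: sum_distrib_left sum_distrib_right mult_ac)
      ultimately have "(\<Sum>w\<in>F. c z w * (\<phi> z * \<phi> w) * (u z)\<^sup>2) = (C z * \<phi> z - b z) * \<phi> z * (u z)\<^sup>2"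
        by simp
      then show ?thesis by (simp add: g_def power2_eq_square algebra_simps)
    qed
    then have X: "X = (\<Sum>z\<in>F. C z * (g z)\<^sup>2) - (\<Sum>z\<in>F. \<phi> z * (b z * (u z)\<^sup>2))"
      by (simp add: X_def sum_subtractf)
    have gLg: "(\<Sum>z\<in>F. g z * L g z) = (\<Sum>z\<in>F. C z * (g z)\<^sup>2) - Y"
      by (simp add: Y_def L_def right_diff_distrib sum_subtractf sum_distrib_left power2_eq_square algebra_simps)
    have gLh: "(\<Sum>z\<in>F. g z * L h z) = (\<Sum>z\<in>F. \<phi> z * (\<beta> z * u z))"
      by (intro sum.cong refl) (simp add: Lh g_def)
    have "(\<Sum>z\<in>F. \<phi> z * (\<sigma> z - 2 * (\<beta> z * u z) + b z * (u z)\<^sup>2)) = (\<Sum>z\<in>F. \<sigma> z * \<phi> z)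
        - 2 * (\<Sum>z\<in>F. \<phi> z * (\<beta> z * u z)) + (\<Sum>z\<in>F. \<phi> z * (b z * (u z)\<^sup>2))"
      by (simp add: sum_distrib_left sum.distrib sum_subtractf algebra_simps)
    then show ?thesis
      using quad X gLg gLh by linarith
  qed
  \<comment> \<open>drop the weights, which lie between 0 and 1\<close>
  also have "\<dots> \<le> (\<Sum>z\<in>F. \<Sum>x\<in>H. c z x * (u x - u z)\<^sup>2) + (\<Sum>z\<in>F. \<Sum>w\<in>F. c z w * (u z - u w)\<^sup>2) / 2"
  proof (intro add_mono divide_right_mono sum_mono)
    fix z assume z: "z \<in> F"
    have "\<sigma> z - 2 * (\<beta> z * u z) + b z * (u z)\<^sup>2 = (\<Sum>x\<in>H. c z x * (u x - u z)\<^sup>2)"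
      by (simp add: \<sigma>_def \<beta>_def b_def power2_eq_square sum_distrib_left sum_distrib_right
          sum.distrib [symmetric] sum_subtractf [symmetric] algebra_simps)
    moreover have "0 \<le> (\<Sum>x\<in>H. c z x * (u x - u z)\<^sup>2)"
      using z c0 by (intro sum_nonneg) auto
    ultimately show "\<phi> z * (\<sigma> z - 2 * (\<beta> z * u z) + b z * (u z)\<^sup>2) \<le> (\<Sum>x\<in>H. c z x * (u x - u z)\<^sup>2)"
      using \<phi>01[OF z] by (simp add: mult_left_le_one_le)
  next
    fix z w assume "z \<in> F" "w \<in> F"
    then show "c z w * (\<phi> z * \<phi> w) * (u z - u w)\<^sup>2 \<le> c z w * (u z - u w)\<^sup>2"
      using \<phi>01 c0 by (intro mult_right_mono mult_right_le_one_le mult_le_one) auto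
  qed auto
  also have "energy H c u + \<dots> = energy (H \<union> F) c u"
  proof -
    have "(\<Sum>x\<in>H. \<Sum>z\<in>F. c x z * (u x - u z)\<^sup>2) = (\<Sum>z\<in>F. \<Sum>x\<in>H. c z x * (u x - u z)\<^sup>2)"
      by (subst sum.swap) (auto intro!: sum.cong simp: sym)
    moreover have "(\<Sum>z\<in>F. \<Sum>x\<in>H. c z x * (u z - u x)\<^sup>2) = (\<Sum>z\<in>F. \<Sum>x\<in>H. c z x * (u x - u z)\<^sup>2)"
      by (simp add: power2_commute)
    ultimately show ?thesis
      unfolding dirichlet_form_def power2_eq_square [symmetric]
      by (simp add: sum.union_disjoint fin disj sum.distrib)
  qed
  finally show ?thesis by simp
qed

text \<open>
  Monotone convergence for sums over growing finite sets.  Summability of the limit is part of the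
  conclusion, so that nested sums can be treated one at a time with nothing but bounds on finite sums.
\<close>

lemma monotone_convergence_sum:
  fixes f :: "nat \<Rightarrow> 'b \<Rightarrow> real"
  assumes D: "incseq D" "(\<Union>m. D m) = U" and fin: "\<And>m. finite (D m)"
    and f0: "\<And>m z. z \<in> U \<Longrightarrow> 0 \<le> f m z"
    and mono: "\<And>m n z. z \<in> U \<Longrightarrow> m \<le> n \<Longrightarrow> f m z \<le> f n z"
    and lim: "\<And>z. z \<in> U \<Longrightarrow> (\<lambda>m. f m z) \<longlonglongrightarrow> g z"
    and bd: "\<forall>\<^sub>F m in sequentially. (\<Sum>z\<in>D m. f m z) \<le> B"
  shows "g summable_on U" "(\<lambda>m. \<Sum>z\<in>D m. f m z) \<longlonglongrightarrow> (\<Sum>\<^sub>\<infinity>z\<in>U. g z)"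
proof -
  have DU: "D m \<subseteq> U" for m using D by auto
  define s where "s m = (\<Sum>z\<in>D m. f m z)" for m
  have g0: "0 \<le> g z" if "z \<in> U" for z
    using LIMSEQ_le_const[OF lim[OF that], of 0] f0[OF that] by blast
  have fg: "f m z \<le> g z" if "z \<in> U" for z m
    using LIMSEQ_le_const[OF lim[OF that], of "f m z"] mono[OF that] by blast
  have inc: "incseq s"
  proof (rule incseq_SucI)
    fix m
    have "s m \<le> (\<Sum>z\<in>D m. f (Suc m) z)"
      unfolding s_def using DU by (intro sum_mono mono) auto
    also have "\<dots> \<le> s (Suc m)"
      unfolding s_def using DU f0 fin incseq_SucD[OF D(1)] by (intro sum_mono2) blast+
    finally show "s m \<le> s (Suc m)" .
  qed
  from bd obtain M where M: "\<And>m. m \<ge> M \<Longrightarrow> s m \<le> B"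
    by (auto simp: eventually_sequentially s_def)
  have "s m \<le> B" for m
    using incseqD[OF inc, of m "max m M"] M[of "max m M"] by simp
  then obtain L where L: "s \<longlonglongrightarrow> L" "\<And>m. s m \<le> L"
    using incseq_convergent[OF inc] by blast
  have fs: "sum g S \<le> L" if S: "finite S" "S \<subseteq> U" for S
  proof -
    have "\<exists>m. S \<subseteq> D m"
      using S
    proof (induction S rule: finite_induct)
      case (insert x S)
      then obtain m n where "S \<subseteq> D m" "x \<in> D n" using D by auto
      then have "insert x S \<subseteq> D (max m n)"
        using incseqD[OF D(1), of m "max m n"] incseqD[OF D(1), of n "max m n"] by auto
      then show ?case by blast
    qed auto
    then obtain m where m: "S \<subseteq> D m" by blast
    have "(\<Sum>z\<in>S. f n z) \<le> L" if "n \<ge> m" for n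
    proof -
      have "(\<Sum>z\<in>S. f n z) \<le> s n"
        unfolding s_def using DU f0 fin m incseqD[OF D(1) that] by (intro sum_mono2) auto
      then show ?thesis using L(2) order_trans by blast
    qed
    moreover have "(\<lambda>n. \<Sum>z\<in>S. f n z) \<longlonglongrightarrow> sum g S"
      using S lim by (intro tendsto_sum) auto
    ultimately show ?thesis
      by (intro LIMSEQ_le_const2) auto
  qed
  then show sm: "g summable_on U"
    using g0 by (intro nonneg_bdd_above_summable_on) (auto intro!: bdd_aboveI)
  have "s m \<le> infsum g U" for m
  proof -
    have "s m \<le> sum g (D m)"
      unfolding s_def using DU fg by (intro sum_mono) auto
    also have "\<dots> \<le> infsum g U"
      using sm fin DU g0 by (intro finite_sum_le_infsum) auto
    finally show ?thesis .
  qed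
  then have "L \<le> infsum g U"
    using L(1) LIMSEQ_le_const2 by blast
  moreover have "infsum g U \<le> L"
    using sm fs by (intro infsum_le_finite_sums) auto
  ultimately show "(\<lambda>m. \<Sum>z\<in>D m. f m z) \<longlonglongrightarrow> (\<Sum>\<^sub>\<infinity>z\<in>U. g z)"
    using L(1) by (simp add: s_def [abs_def])
qed

lemma eventually_in_incseq:
  assumes "incseq F" "(\<Union>m. F m) = U" "x \<in> U"
  shows "\<forall>\<^sub>F m in sequentially. x \<in> F m"
proof -
  obtain m where "x \<in> F m" using assms by auto
  then show ?thesis
    using incseqD[OF assms(1)] by (auto simp: eventually_sequentially)
qed

section \<open>Resistance networks\<close>

locale network =
  fixes V :: "'a set" and c :: "'a \<Rightarrow> 'a \<Rightarrow> real"
  assumes network: "resistance_network V c"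
begin

abbreviation "P \<equiv> trans_prob V c"
abbreviation "C \<equiv> total_cond V c"

lemma c_nonneg: "x \<in> V \<Longrightarrow> y \<in> V \<Longrightarrow> 0 \<le> c x y"
  and c_sym: "x \<in> V \<Longrightarrow> y \<in> V \<Longrightarrow> c x y = c y x"
  and c_diag: "x \<in> V \<Longrightarrow> c x x = 0"
  and c_summable: "x \<in> V \<Longrightarrow> c x summable_on V"
  and connected: "x \<in> V \<Longrightarrow> y \<in> V \<Longrightarrow> (x, y) \<in> (edge_rel V c)\<^sup>*"
  using network by (auto simp: resistance_network_def connected_network_def)

lemma sum_c_le: "x \<in> V \<Longrightarrow> finite S \<Longrightarrow> S \<subseteq> V \<Longrightarrow> (\<Sum>y\<in>S. c x y) \<le> C x"
  unfolding total_cond_def by (intro finite_sum_le_infsum) (auto simp: c_summable c_nonneg)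

lemma c_le_C: "x \<in> V \<Longrightarrow> y \<in> V \<Longrightarrow> c x y \<le> C x"
  using sum_c_le[of x "{y}"] by simp

lemma C_nonneg: "x \<in> V \<Longrightarrow> 0 \<le> C x"
  using sum_c_le[of x "{}"] by simp

lemma C_mult_P: "x \<in> V \<Longrightarrow> y \<in> V \<Longrightarrow> C x * P x y = c x y"
  using c_le_C[of x y] c_nonneg[of x y] by (auto simp: trans_prob_def)

lemma P_nonneg: "x \<in> V \<Longrightarrow> y \<in> V \<Longrightarrow> 0 \<le> P x y"
  by (simp add: trans_prob_def c_nonneg C_nonneg)

lemma sum_P_le: "x \<in> V \<Longrightarrow> finite S \<Longrightarrow> S \<subseteq> V \<Longrightarrow> (\<Sum>y\<in>S. P x y) \<le> 1"
  using sum_c_le[of x S] C_nonneg[of x]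
  by (cases "C x = 0") (auto simp: trans_prob_def sum_divide_distrib [symmetric])

lemma C_pos:
  assumes "x \<in> V" "y \<in> V" "x \<noteq> y"
  shows "0 < C x"
proof -
  from connected[OF assms(1,2)] assms(3) obtain z where "(x, z) \<in> edge_rel V c"
    by (meson converse_rtranclE)
  then show ?thesis
    using c_le_C[of x z] by (auto simp: edge_rel_def)
qed

text \<open>
  A summable family has countable support, so every vertex has countably many neighbours, and
  connectedness bounds the number of vertices by that of finite paths.
\<close>

lemma countable_vertices: "countable V"
proof -
  obtain a where a: "a \<in> V"
    using network by (auto simp: resistance_network_def connected_network_def)
  have "countable (edge_rel V c `` {x})" for x
  proof (cases "x \<in> V")
    case True
    have "edge_rel V c `` {x} \<subseteq> {y \<in> V. c x y \<noteq> 0}"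
      by (auto simp: edge_rel_def)
    then show ?thesis
      using summable_countable_real[OF c_summable[OF True]] countable_subset by blast
  next
    case False
    then have "edge_rel V c `` {x} = {}" by (auto simp: edge_rel_def)
    then show ?thesis by simp
  qed
  then have "countable (edge_rel V c `` Y)" if "countable Y" for Y
    using that by (rule countable_Image)
  then have "countable ((edge_rel V c)\<^sup>* `` {a})"
    by (rule countable_rtrancl) auto
  moreover have "V \<subseteq> (edge_rel V c)\<^sup>* `` {a}"
    using connected[OF a] by auto
  ultimately show ?thesis
    by (rule countable_subset [rotated])
qed

lemma connected_network_path:
  assumes "(a, v) \<in> (edge_rel V c)\<^sup>*" "a \<in> V"
  shows "\<exists>W. finite W \<and> W \<subseteq> V \<and> a \<in> W \<and> v \<in> W \<and> connected_network W c"
  using assms(1)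
proof (induction rule: rtrancl_induct)
  case base
  show ?case using assms(2) by (intro exI[of _ "{a}"]) (auto simp: connected_network_def)
next
  case (step y z)
  then obtain W where W: "finite W" "W \<subseteq> V" "a \<in> W" "y \<in> W" "connected_network W c" by blast
  have yz: "y \<in> V" "z \<in> V" "c y z > 0" "c z y > 0"
    using step(2) c_sym by (auto simp: edge_rel_def)
  let ?E = "edge_rel (insert z W) c"
  have sub: "(edge_rel W c)\<^sup>* \<subseteq> ?E\<^sup>*"
    by (intro rtrancl_mono) (auto simp: edge_rel_def)
  have "(x, y) \<in> ?E\<^sup>* \<and> (y, x) \<in> ?E\<^sup>*" if "x \<in> insert z W" for x
  proof (cases "x \<in> W")
    case True
    then show ?thesis using W sub by (auto simp: connected_network_def)
  next
    case False
    then have "x = z" using that by simp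
    then have "(x, y) \<in> ?E" "(y, x) \<in> ?E" using yz W by (auto simp: edge_rel_def)
    then show ?thesis by blast
  qed
  then have "connected_network (insert z W) c"
    unfolding connected_network_def by (auto intro: rtrancl_trans)
  then show ?case using W yz by (intro exI[of _ "insert z W"]) auto
qed

text \<open>
  Join \<open>a\<close> to each vertex by a finite connected set.  Unions of such sets are connected because all of
  them contain \<open>a\<close>.
\<close>

lemma exhaustion_exists:
  assumes "a \<in> V" "b \<in> V"
  obtains G where "exhaustion V c G" "\<And>k. a \<in> G k \<and> b \<in> G k"
proof -
  have "\<forall>v\<in>V. \<exists>W. finite W \<and> W \<subseteq> V \<and> a \<in> W \<and> v \<in> W \<and> connected_network W c"
    using connected_network_path[OF connected[OF assms(1)] assms(1)] by blast
  then obtain S where S: "\<And>v. v \<in> V \<Longrightarrow> finite (S v) \<and> S v \<subseteq> V \<and> a \<in> S v \<and> v \<in> S v \<and> connected_network (S v) c"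
    by metis
  define e where "e = from_nat_into V"
  have e: "range e = V"
    unfolding e_def using countable_vertices assms(1) by (intro range_from_nat_into) auto
  define G where "G n = S b \<union> (\<Union>i\<in>{..n}. S (e i))" for n
  have G: "finite (G n)" "G n \<subseteq> V" "a \<in> G n" "b \<in> G n" for n
    using S e assms unfolding G_def by auto
  have "connected_network (G n) c" for n
  proof -
    have "(x, a) \<in> (edge_rel (G n) c)\<^sup>* \<and> (a, x) \<in> (edge_rel (G n) c)\<^sup>*" if x: "x \<in> G n" for x
    proof -
      have "\<exists>v\<in>V. x \<in> S v \<and> S v \<subseteq> G n"
      proof (cases "x \<in> S b")
        case False
        then obtain i where "i \<le> n" "x \<in> S (e i)" using x unfolding G_def by auto
        then show ?thesis using e by (intro bexI[of _ "e i"]) (auto simp: G_def)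
      qed (use assms(2) in \<open>auto simp: G_def\<close>)
      then obtain v where v: "v \<in> V" "x \<in> S v" "S v \<subseteq> G n" by blast
      have "(edge_rel (S v) c)\<^sup>* \<subseteq> (edge_rel (G n) c)\<^sup>*"
        using v by (intro rtrancl_mono) (auto simp: edge_rel_def)
      then show ?thesis
        using S[OF v(1)] v(2) by (auto simp: connected_network_def)
    qed
    then show ?thesis
      using G(3)[of n] unfolding connected_network_def by (auto intro: rtrancl_trans)
  qed
  moreover have "incseq G"
    by (intro incseq_SucI) (auto simp: G_def)
  moreover have "(\<Union>k. G k) = V"
  proof
    show "V \<subseteq> (\<Union>k. G k)"
    proof
      fix v assume "v \<in> V"
      then obtain i where "v = e i" using e by blast
      then have "v \<in> G i" using S[OF \<open>v \<in> V\<close>] by (auto simp: G_def)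
      then show "v \<in> (\<Union>k. G k)" by blast
    qed
  qed (use G in auto)
  ultimately have "exhaustion V c G"
    using G by (simp add: exhaustion_def)
  then show ?thesis using that G by blast
qed

lemma finite_subnetwork:
  assumes "finite W" "W \<subseteq> V" "connected_network W c"
  shows "resistance_network W c"
  unfolding resistance_network_def
proof (intro conjI ballI)
  fix x assume x: "x \<in> W"
  show "c x x = 0" using x assms(2) by (intro c_diag) auto
  show "c x summable_on W" using assms(1) by simp
  fix y assume y: "y \<in> W"
  show "0 \<le> c x y" using x y assms(2) by (intro c_nonneg) auto
  show "c x y = c y x" using x y assms(2) by (intro c_sym) auto
qed (rule assms)

section \<open>The walk killed outside a finite set\<close>

abbreviation "PP F \<equiv> mat_pow F P"

lemma mat_pow_finite_Suc: "finite F \<Longrightarrow> PP F (Suc n) x y = (\<Sum>z\<in>F. P x z * PP F n z y)"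
  by (simp add: mat_prod_def)

lemma mat_pow_nonneg:
  assumes "finite F" "F \<subseteq> V" "x \<in> V"
  shows "0 \<le> PP F n x y"
  using assms(3)
proof (induction n arbitrary: x)
  case (Suc n)
  then show ?case
    unfolding mat_pow_finite_Suc[OF assms(1)] using assms P_nonneg by (intro sum_nonneg mult_nonneg_nonneg) auto
qed simp

lemma mat_pow_le_1:
  assumes "finite F" "F \<subseteq> V" "x \<in> V"
  shows "PP F n x y \<le> 1"
  using assms(3)
proof (induction n arbitrary: x)
  case (Suc n)
  have "PP F (Suc n) x y \<le> (\<Sum>z\<in>F. P x z * 1)"
    unfolding mat_pow_finite_Suc[OF assms(1)] using assms P_nonneg Suc
    by (intro sum_mono mult_left_mono) auto
  also have "\<dots> \<le> 1" using sum_P_le Suc assms by simp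
  finally show ?case .
qed simp

lemma mat_pow_mono:
  assumes "finite F'" "F \<subseteq> F'" "F' \<subseteq> V" "x \<in> V"
  shows "PP F n x y \<le> PP F' n x y"
  using assms(4)
proof (induction n arbitrary: x)
  case (Suc n)
  have fin: "finite F" using assms finite_subset by blast
  have "PP F (Suc n) x y \<le> (\<Sum>z\<in>F. P x z * PP F' n z y)"
    unfolding mat_pow_finite_Suc[OF fin] using assms P_nonneg Suc
    by (intro sum_mono mult_left_mono) auto
  also have "\<dots> \<le> PP F' (Suc n) x y"
    unfolding mat_pow_finite_Suc[OF assms(1)] using assms P_nonneg Suc mat_pow_nonneg
    by (intro sum_mono2) (auto intro!: mult_nonneg_nonneg mat_pow_nonneg)
  finally show ?case .
qed simp

lemma mat_pow_Suc_right:
  assumes "finite F" "x \<in> F" "y \<in> F"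
  shows "PP F (Suc n) x y = (\<Sum>z\<in>F. PP F n x z * P z y)"
  using assms(2)
proof (induction n arbitrary: x)
  case 0
  have "(\<Sum>z\<in>F. P x z * (if z = y then 1 else 0)) = P x y"
    "(\<Sum>z\<in>F. (if x = z then 1 else 0) * P z y) = P x y"
    using assms 0 by (simp_all add: sum.delta if_distrib if_distribR cong: if_cong)
  then show ?case
    by (simp add: mat_prod_def assms(1))
next
  case (Suc n)
  have "PP F (Suc (Suc n)) x y = (\<Sum>w\<in>F. P x w * (\<Sum>z\<in>F. PP F n w z * P z y))"
    unfolding mat_pow_finite_Suc[OF assms(1), of "Suc n"] using Suc by (intro sum.cong refl) simp
  also have "\<dots> = (\<Sum>z\<in>F. (\<Sum>w\<in>F. P x w * PP F n w z) * P z y)"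
    unfolding sum_distrib_left sum_distrib_right mult.assoc by (rule sum.swap)
  also have "\<dots> = (\<Sum>z\<in>F. PP F (Suc n) x z * P z y)"
    unfolding mat_pow_finite_Suc[OF assms(1)] ..
  finally show ?case .
qed

text \<open>
  Detailed balance.  The induction peels the first step off on the left-hand side and the last step on
  the right-hand side.
\<close>

lemma mat_pow_reversible:
  assumes "finite F" "F \<subseteq> V" "x \<in> F" "y \<in> F"
  shows "C x * PP F n x y = C y * PP F n y x"
  using assms(3)
proof (induction n arbitrary: x)
  case (Suc n)
  have "C x * PP F (Suc n) x y = (\<Sum>z\<in>F. P z x * (C z * PP F n z y))"
    unfolding mat_pow_finite_Suc[OF assms(1)] sum_distrib_left
  proof (intro sum.cong refl)
    fix z assume "z \<in> F"
    then have "C x * P x z = c x z" "C z * P z x = c x z"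
      using Suc(2) assms(2) by (auto simp: C_mult_P c_sym subset_iff)
    then have "C x * P x z = C z * P z x" by simp
    then have "C x * P x z * PP F n z y = C z * P z x * PP F n z y" by simp
    then show "C x * (P x z * PP F n z y) = P z x * (C z * PP F n z y)"
      by (simp only: mult_ac)
  qed
  also have "\<dots> = (\<Sum>z\<in>F. P z x * (C y * PP F n y z))"
    using Suc by simp
  also have "\<dots> = C y * PP F (Suc n) y x"
    unfolding mat_pow_Suc_right[OF assms(1,4) Suc(2)] sum_distrib_left by (simp add: mult_ac)
  finally show ?case .
qed simp

text \<open>
  The expected number of visits to \<open>y\<close> during the first \<open>N\<close> time units (\<open>0\<close> to \<open>N - 1\<close>) of the walk from
  \<open>x\<close> that is killed outside \<open>F\<close>: a partial sum of the Neumann series.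
\<close>

definition green :: "'a set \<Rightarrow> nat \<Rightarrow> 'a \<Rightarrow> 'a \<Rightarrow> real" where
  "green F N x y = (\<Sum>n<N. PP F n x y)"

lemma green_nonneg: "finite F \<Longrightarrow> F \<subseteq> V \<Longrightarrow> x \<in> V \<Longrightarrow> 0 \<le> green F N x y"
  unfolding green_def by (intro sum_nonneg mat_pow_nonneg) auto

lemma green_mono:
  assumes "finite F'" "F \<subseteq> F'" "F' \<subseteq> V" "x \<in> V" "N \<le> N'"
  shows "green F N x y \<le> green F' N' x y"
proof -
  have "green F N x y \<le> green F' N x y"
    unfolding green_def using assms by (intro sum_mono mat_pow_mono) auto
  also have "\<dots> \<le> green F' N' x y"
    unfolding green_def using assms by (intro sum_mono2 mat_pow_nonneg) auto
  finally show ?thesis .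
qed

lemma green_Suc:
  assumes "finite F"
  shows "green F (Suc N) x y = (if x = y then 1 else 0) + (\<Sum>z\<in>F. P x z * green F N z y)"
proof -
  have "(\<Sum>n<N. PP F (Suc n) x y) = (\<Sum>z\<in>F. P x z * green F N z y)"
    unfolding green_def sum_distrib_left mat_pow_finite_Suc[OF assms] by (rule sum.swap)
  then show ?thesis
    unfolding green_def sum.lessThan_Suc_shift by simp
qed

lemma green_reversible:
  assumes "finite F" "F \<subseteq> V" "x \<in> F" "y \<in> F"
  shows "C x * green F N x y = C y * green F N y x"
  unfolding green_def sum_distrib_left using mat_pow_reversible[OF assms] by simp

text \<open>
  For \<open>y\<close> outside \<open>F\<close>, the probability that the walk from \<open>x\<close> leaves \<open>F\<close> within \<open>N\<close> steps and does so
  into \<open>y\<close>.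
\<close>

definition hit :: "'a set \<Rightarrow> nat \<Rightarrow> 'a \<Rightarrow> 'a \<Rightarrow> real" where
  "hit F N x y = (\<Sum>w\<in>F. green F N x w * P w y)"

lemma hit_nonneg: "finite F \<Longrightarrow> F \<subseteq> V \<Longrightarrow> x \<in> V \<Longrightarrow> y \<in> V \<Longrightarrow> 0 \<le> hit F N x y"
  unfolding hit_def by (intro sum_nonneg mult_nonneg_nonneg green_nonneg P_nonneg) auto

lemma hit_mono:
  assumes "finite F'" "F \<subseteq> F'" "F' \<subseteq> V" "x \<in> V" "y \<in> V" "N \<le> N'"
  shows "hit F N x y \<le> hit F' N' x y"
proof -
  have "hit F N x y \<le> (\<Sum>w\<in>F. green F' N' x w * P w y)"
    unfolding hit_def using assms P_nonneg by (intro sum_mono mult_right_mono green_mono) auto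
  also have "\<dots> \<le> hit F' N' x y"
    unfolding hit_def using assms P_nonneg green_nonneg by (intro sum_mono2 mult_nonneg_nonneg) auto
  finally show ?thesis .
qed

lemma hit_Suc:
  assumes "finite F" "x \<in> F"
  shows "hit F (Suc N) x y = P x y + (\<Sum>z\<in>F. P x z * hit F N z y)"
proof -
  have "(\<Sum>w\<in>F. (if x = w then 1 else 0) * P w y) = P x y"
    using assms by (simp add: sum.delta if_distrib if_distribR cong: if_cong)
  moreover have "(\<Sum>w\<in>F. (\<Sum>z\<in>F. P x z * green F N z w) * P w y) = (\<Sum>z\<in>F. P x z * hit F N z y)"
    unfolding hit_def sum_distrib_left sum_distrib_right mult.assoc by (rule sum.swap)
  ultimately show ?thesis
    by (subst hit_def) (simp add: green_Suc[OF assms(1)] distrib_right sum.distrib)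
qed

text \<open>
  The exits into different vertices are disjoint events.  The induction conditions on the first step.
\<close>

lemma sum_hit_le_1:
  assumes "finite F" "F \<subseteq> V" "finite Y" "Y \<subseteq> V" "F \<inter> Y = {}" "x \<in> F"
  shows "(\<Sum>y\<in>Y. hit F N x y) \<le> 1"
  using assms(6)
proof (induction N arbitrary: x)
  case 0
  then show ?case by (simp add: hit_def green_def)
next
  case (Suc N)
  have "(\<Sum>y\<in>Y. hit F (Suc N) x y) = (\<Sum>y\<in>Y. P x y) + (\<Sum>z\<in>F. P x z * (\<Sum>y\<in>Y. hit F N z y))"
    unfolding hit_Suc[OF assms(1) Suc(2)] sum.distrib sum_distrib_left by (subst sum.swap) simp
  also have "\<dots> \<le> (\<Sum>y\<in>Y. P x y) + (\<Sum>z\<in>F. P x z * 1)"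
    using Suc assms by (intro add_left_mono sum_mono mult_left_mono P_nonneg) auto
  also have "\<dots> = (\<Sum>y\<in>Y \<union> F. P x y)"
    using assms by (subst sum.union_disjoint) auto
  also have "\<dots> \<le> 1"
    using assms Suc by (intro sum_P_le) auto
  finally show ?case .
qed

lemma hit_le_1: 
  assumes "finite F" "F \<subseteq> V" "x \<in> F" "y \<in> V - F"
  shows "hit F N x y \<le> 1"
  using sum_hit_le_1[of F "{y}" x N] assms by simp

text \<open>
  For \<open>y\<close> in \<open>F\<close> the sum defining \<open>hit\<close> counts visits to \<open>y\<close> after time \<open>0\<close>.
\<close>

lemma hit_le_green:
  assumes "finite F" "x \<in> F" "y \<in> F" 
  shows "hit F N x y \<le> green F (Suc N) x y"
proof -
  have "hit F N x y = (\<Sum>n<N. PP F (Suc n) x y)"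
    unfolding hit_def green_def sum_distrib_right mat_pow_Suc_right[OF assms] by (rule sum.swap)
  then show ?thesis
    unfolding green_def sum.lessThan_Suc_shift by simp
qed

text \<open>
  The bound is uniform in \<open>F\<close>, in the number of steps and in the starting point, so it gives the
  convergence of the Neumann series on any part of the complement of \<open>H\<close>.

  Follow a path from \<open>w\<close> to \<open>H\<close>.  Each visit to a vertex is followed, with a fixed probability, by a
  step to the next vertex of the path; so its expected number of visits is at most a constant times
  that of the next vertex if the latter lies in \<open>F\<close> (\<open>hit_le_green\<close>), and at most a constant if it does
  not, because the walk leaves \<open>F\<close> only once (\<open>sum_hit_le_1\<close>).  The latter happens at the end
  of the path at the latest.
\<close>

lemma green_bounded:
  assumes "H \<subseteq> V" "H \<noteq> {}" "w \<in> V"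
  obtains K where "\<And>F N x. finite F \<Longrightarrow> F \<subseteq> V - H \<Longrightarrow> x \<in> F \<Longrightarrow> green F N x w \<le> K"
proof -
  \<comment> \<open>the case w outside F is treated at the end, since bd is then vacuous\<close>
  define bd where "bd w K \<longleftrightarrow> (\<forall>F N x. finite F \<longrightarrow> F \<subseteq> V - H \<longrightarrow> x \<in> F \<longrightarrow> w \<in> F \<longrightarrow> green F N x w \<le> K)"
    for w K
  obtain h where h: "h \<in> H" "h \<in> V" using assms by blast
  have "\<exists>K\<ge>1. bd w K"
    using connected[OF assms(3) h(2)]
  proof (induction rule: converse_rtrancl_induct)
    case base
    have "bd h 1" using h by (auto simp: bd_def)
    then show ?case by auto
  next
    case (step w w')
    then obtain K where K: "K \<ge> 1" "bd w' K" by blast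
    have ww: "w \<in> V" "w' \<in> V" "c w w' > 0" using step(1) by (auto simp: edge_rel_def)
    then have P: "P w w' > 0" using c_le_C[of w w'] by (simp add: trans_prob_def)
    have "green F N x w \<le> max 1 (K / P w w')" if F: "finite F" "F \<subseteq> V - H" "x \<in> F" "w \<in> F" for F N x
    proof -
      have FV: "F \<subseteq> V" "x \<in> V" using F by auto
      have "green F N x w * P w w' \<le> hit F N x w'"
        unfolding hit_def
      proof (rule member_le_sum)
        fix v assume "v \<in> F - {w}"
        then show "0 \<le> green F N x v * P v w'"
          using FV ww F by (intro mult_nonneg_nonneg green_nonneg P_nonneg) auto
      qed (use F in auto)
      also have "\<dots> \<le> K"
      proof (cases "w' \<in> F")
        case True
        have "hit F N x w' \<le> green F (Suc N) x w'"
          by (rule hit_le_green) (use F True in auto)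
        also have "\<dots> \<le> K"
          using K(2) F True unfolding bd_def by simp
        finally show ?thesis .
      next
        case False
        have "hit F N x w' \<le> 1"
          by (rule hit_le_1) (use F FV ww False in auto)
        then show ?thesis using K(1) by linarith
      qed
      finally have "green F N x w \<le> K / P w w'" using P by (simp add: pos_le_divide_eq)
      then show ?thesis by linarith
    qed
    then have "bd w (max 1 (K / P w w'))"
      unfolding bd_def by simp
    then show ?case by (intro exI[of _ "max 1 (K / P w w')"]) simp
  qed
  then obtain K where K: "K \<ge> 1" "bd w K"
    by blast
  have bound: "green F N x w \<le> K" if F: "finite F" "F \<subseteq> V - H" "x \<in> F" for F N x
  proof (cases "w \<in> F")
    case False
    have "PP F n y w = 0" if "y \<in> F" for n y
      using that
    proof (induction n arbitrary: y)
      case (Suc n)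
      then show ?case by (simp add: mat_pow_finite_Suc[OF F(1)] del: mat_pow.simps)
    qed (use False in auto)
    then show ?thesis using K(1) F(3) by (simp add: green_def)
  next
    case True
    then show ?thesis using K(2) F unfolding bd_def by simp
  qed
  show ?thesis
    by (rule that, rule bound)
qed

section \<open>Potentials and effective resistance\<close>

lemma green_convergent:
  assumes "finite F" "F \<subseteq> V - H" "H \<subseteq> V" "H \<noteq> {}" "x \<in> F" "w \<in> V"
  shows "convergent (\<lambda>N. green F N x w)"
proof -
  obtain K where K: "\<And>F N x. finite F \<Longrightarrow> F \<subseteq> V - H \<Longrightarrow> x \<in> F \<Longrightarrow> green F N x w \<le> K"
    using green_bounded[OF assms(3,4,6)] by blast
  have "incseq (\<lambda>N. green F N x w)"
    unfolding incseq_def using assms by (auto intro!: green_mono)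
  then obtain L where "(\<lambda>N. green F N x w) \<longlonglongrightarrow> L"
    using K[OF assms(1,2,5)] incseq_convergent[of "\<lambda>N. green F N x w" K] by blast
  then show ?thesis by (auto simp: convergent_def)
qed

text \<open>
  The exit probabilities of a finite set, in the form that \<open>energy_trace_le\<close> asks for.  The equation
  is the limit of \<open>hit_Suc\<close>.
\<close>

lemma hit_limit:
  assumes F: "finite F" "F \<subseteq> V - H" and H: "H \<subseteq> V" "H \<noteq> {}" "finite H"
  obtains \<pi> where
    "\<And>N z y. z \<in> F \<Longrightarrow> y \<in> H \<Longrightarrow> hit F N z y \<le> \<pi> z y"
    "\<And>z y. z \<in> F \<Longrightarrow> y \<in> H \<Longrightarrow> 0 \<le> \<pi> z y"
    "\<And>z. z \<in> F \<Longrightarrow> (\<Sum>y\<in>H. \<pi> z y) \<le> 1"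
    "\<And>z y. z \<in> F \<Longrightarrow> y \<in> H \<Longrightarrow> C z * \<pi> z y = c z y + (\<Sum>w\<in>F. c z w * \<pi> w y)"
proof -
  define \<pi> where "\<pi> z y = lim (\<lambda>N. hit F N z y)" for z y
  have FV: "F \<subseteq> V" using F by auto
  have lim: "(\<lambda>N. hit F N z y) \<longlonglongrightarrow> \<pi> z y" if "z \<in> F" for z y
  proof -
    have "convergent (\<lambda>N. \<Sum>w\<in>F. green F N z w * P w y)"
      using green_convergent[OF F H(1,2) that] FV
      by (intro convergent_sum convergent_mult convergent_const) auto
    then show ?thesis
      unfolding \<pi>_def hit_def by (simp add: convergent_LIMSEQ_iff)
  qed
  have le: "hit F N z y \<le> \<pi> z y" if "z \<in> F" "y \<in> H" for N z y
  proof (rule LIMSEQ_le_const[OF lim])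
    show "\<exists>M. \<forall>n\<ge>M. hit F N z y \<le> hit F n z y"
      using that F FV H by (intro exI[of _ N]) (auto intro!: hit_mono)
  qed (rule that)
  show ?thesis
  proof (rule that[OF le])
    fix z assume z: "z \<in> F"
    have "(\<lambda>N. \<Sum>y\<in>H. hit F N z y) \<longlonglongrightarrow> (\<Sum>y\<in>H. \<pi> z y)"
      using lim z by (intro tendsto_sum) auto
    then show "(\<Sum>y\<in>H. \<pi> z y) \<le> 1"
      using F H z FV by (elim LIMSEQ_le_const2) (auto intro!: sum_hit_le_1)
    fix y assume y: "y \<in> H"
    have "0 \<le> hit F 0 z y"
      using z y F FV H by (intro hit_nonneg) auto
    then show "0 \<le> \<pi> z y" using le[OF z y, of 0] by linarith
    have "(\<lambda>N. P z y + (\<Sum>w\<in>F. P z w * hit F N w y)) \<longlonglongrightarrow> P z y + (\<Sum>w\<in>F. P z w * \<pi> w y)"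
      using lim by (intro tendsto_intros) auto
    then have "(\<lambda>N. hit F (Suc N) z y) \<longlonglongrightarrow> P z y + (\<Sum>w\<in>F. P z w * \<pi> w y)"
      by (simp only: hit_Suc[OF F(1) z])
    moreover have "(\<lambda>N. hit F (Suc N) z y) \<longlonglongrightarrow> \<pi> z y"
      using lim[OF z] by (rule LIMSEQ_Suc)
    ultimately have "\<pi> z y = P z y + (\<Sum>w\<in>F. P z w * \<pi> w y)"
      using LIMSEQ_unique by blast
    then have "C z * \<pi> z y = C z * P z y + (\<Sum>w\<in>F. C z * P z w * \<pi> w y)"
      by (simp add: distrib_left sum_distrib_left mult.assoc)
    also have "\<dots> = c z y + (\<Sum>w\<in>F. c z w * \<pi> w y)"
      using z y FV H by (simp add: C_mult_P subset_iff)
    finally show "C z * \<pi> z y = c z y + (\<Sum>w\<in>F. c z w * \<pi> w y)" .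
  qed
qed

text \<open>
  The potential is the Green function with pole \<open>a\<close> of the walk killed at \<open>b\<close>.  This gives the equation
  away from \<open>b\<close>, and at \<open>b\<close> it follows because the values of a Laplacian add up to \<open>0\<close>.
\<close>

lemma potential_exists:
  assumes fin: "finite V" and ab: "a \<in> V" "b \<in> V"
  shows "\<exists>v. \<forall>z\<in>V. laplacian V c v z = indicator {a} z - indicator {b} z"
proof (cases "a = b")
  case True
  then show ?thesis by (intro exI[of _ "\<lambda>_. 0"]) (simp add: laplacian_def)
next
  case False
  define F where "F = V - {b}"
  have F: "finite F" "F \<subseteq> V - {b}" "a \<in> F" "V = insert b F" "b \<notin> F"
    using fin ab False by (auto simp: F_def)
  define g where "g z = lim (\<lambda>N. green F N z a)" for z
  define v where "v z = (if z = b then 0 else g z / C a)" for z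
  have Ca: "0 < C a" using C_pos ab False by blast
  have lim: "(\<lambda>N. green F N z a) \<longlonglongrightarrow> g z" if "z \<in> F" for z
    using green_convergent[OF F(1,2) _ _ that ab(1)] ab
    by (simp add: g_def convergent_LIMSEQ_iff)
  have lap: "laplacian V c v z = indicator {a} z" if z: "z \<in> F" for z
  proof -
    have zV: "z \<in> V" using z F by auto
    have "(\<lambda>N. green F (Suc N) z a) \<longlonglongrightarrow> (if z = a then 1 else 0) + (\<Sum>w\<in>F. P z w * g w)"
      unfolding green_Suc[OF F(1)] using lim by (intro tendsto_intros) auto
    then have "g z = (if z = a then 1 else 0) + (\<Sum>w\<in>F. P z w * g w)"
      using LIMSEQ_Suc[OF lim[OF z]] LIMSEQ_unique by blast
    then have "C z * g z = C z * (if z = a then 1 else 0) + (\<Sum>w\<in>F. C z * P z w * g w)"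
      by (simp add: distrib_left sum_distrib_left mult.assoc)
    also have "\<dots> = (if z = a then C a else 0) + (\<Sum>w\<in>F. c z w * g w)"
    proof -
      have "(\<Sum>w\<in>F. C z * P z w * g w) = (\<Sum>w\<in>F. c z w * g w)"
        using zV by (intro sum.cong refl) (auto simp: C_mult_P F_def)
      then show ?thesis by simp
    qed
    finally have g: "C z * g z / C a = indicator {a} z + (\<Sum>w\<in>F. c z w * g w) / C a"
      using Ca by (simp add: add_divide_distrib)
    have "laplacian V c v z = C z * v z - (\<Sum>w\<in>V. c z w * v w)"
      using fin by (simp add: laplacian_def total_cond_def right_diff_distrib sum_subtractf sum_distrib_right)
    also have "(\<Sum>w\<in>V. c z w * v w) = (\<Sum>w\<in>F. c z w * (g w / C a))"
      by (rule sum.mono_neutral_cong_right) (use fin in \<open>auto simp: v_def F_def\<close>)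
    also have "\<dots> = (\<Sum>w\<in>F. c z w * g w) / C a"
      by (simp add: sum_divide_distrib)
    also have "C z * v z = C z * g z / C a"
      using z F(5) by (auto simp: v_def)
    finally show ?thesis
      using g by simp
  qed
  have "(\<Sum>z\<in>V. laplacian V c v z) = 0"
    using sum_mult_laplacian[of V c "\<lambda>_. 1" v] fin c_sym by (simp add: dirichlet_form_def)
  moreover have "(\<Sum>z\<in>F. laplacian V c v z) = 1"
    using F(1,3) by (simp add: lap indicator_def)
  moreover have "(\<Sum>z\<in>V. laplacian V c v z) = laplacian V c v b + (\<Sum>z\<in>F. laplacian V c v z)"
    unfolding F_def by (rule sum.remove) (use fin ab in auto)
  ultimately have "laplacian V c v b = -1"
    by simp
  then show ?thesis
    using lap F False by (intro exI[of _ v]) (auto simp: indicator_def)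
qed

text \<open>
  For a potential \<open>v\<close> and any \<open>u\<close>, summation by parts gives \<open>dirichlet_form V c u v = u a - u b\<close>.  With
  two potentials this shows that the resistance is well defined; with \<open>u = v\<close> that it is the energy of
  \<open>v\<close>; and the Cauchy-Schwarz inequality turns it into the variational principle.
\<close>

lemma eff_resistance_potential:
  assumes fin: "finite V" and ab: "a \<in> V" "b \<in> V"
  obtains v where "eff_resistance V c a b = v a - v b"
    "energy V c v = eff_resistance V c a b"
    "\<And>u. (u a - u b)\<^sup>2 \<le> energy V c u * eff_resistance V c a b"
proof -
  define pot where "pot v \<longleftrightarrow> (\<forall>z\<in>V. laplacian V c v z = indicator {a} z - indicator {b} z)" for v
  have form: "dirichlet_form V c u v = u a - u b" if "pot v" for u v
  proof -
    have "dirichlet_form V c u v = (\<Sum>z\<in>V. u z * indicator {a} z - u z * indicator {b} z)"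
      using that sum_mult_laplacian[of V c u v] fin c_sym by (simp add: pot_def right_diff_distrib)
    also have "\<dots> = u a - u b"
      using fin ab by (simp add: sum_subtractf indicator_def sum.delta if_distrib cong: if_cong)
    finally show ?thesis .
  qed
  obtain v where v: "pot v"
    using potential_exists[OF assms] by (auto simp: pot_def)
  have "r = v a - v b" if "pot w" "r = w a - w b" for w r
    using form[OF v, of w] form[OF that(1), of v] that(2) dirichlet_form_commute[of V c v w] by simp
  then have eff: "eff_resistance V c a b = v a - v b"
    unfolding eff_resistance_def using v unfolding pot_def by (intro the_equality) blast+
  show ?thesis
  proof (rule that[OF eff])
    show en: "energy V c v = eff_resistance V c a b"
      using form[OF v] eff by simp
    show "(u a - u b)\<^sup>2 \<le> energy V c u * eff_resistance V c a b" for u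
      using dirichlet_form_Cauchy_Schwarz[of V c u v] fin c_nonneg form[OF v, of u] en by simp
  qed
qed

lemma eff_resistance_nonneg:
  assumes "finite V" "a \<in> V" "b \<in> V"
  shows "0 \<le> eff_resistance V c a b"
  using eff_resistance_potential[OF assms] energy_nonneg[of V c] c_nonneg by metis

end

text \<open>
  The factor \<open>t\<close> is there for comparisons with networks that dominate only up to a factor close to \<open>1\<close>.
  Test the variational principle on \<open>W\<close> with the potential of \<open>W'\<close>.
\<close>

lemma Rayleigh_monotonicity:
  assumes net: "resistance_network W c" "resistance_network W' c'"
    and fin: "finite W" "finite W'" and ab: "a \<in> W" "b \<in> W" "a \<in> W'" "b \<in> W'"
    and t: "0 \<le> t" "\<And>u. t * energy W c u \<le> energy W' c' u"
  shows "t * eff_resistance W' c' a b \<le> eff_resistance W c a b"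
proof -
  interpret W: network W c by unfold_locales (rule net)
  interpret W': network W' c' by unfold_locales (rule net)
  define R where "R = eff_resistance W c a b"
  define R' where "R' = eff_resistance W' c' a b"
  have nonneg: "0 \<le> R" "0 \<le> R'"
    unfolding R_def R'_def using fin ab by (auto intro: W.eff_resistance_nonneg W'.eff_resistance_nonneg)
  obtain v where v: "R' = v a - v b" "energy W' c' v = R'"
    unfolding R'_def using W'.eff_resistance_potential[OF fin(2) ab(3,4)] by metis
  have "(v a - v b)\<^sup>2 \<le> energy W c v * R"
    unfolding R_def using W.eff_resistance_potential[OF fin(1) ab(1,2)] by metis
  then have "t * R'\<^sup>2 \<le> (t * energy W c v) * R"
    using t(1) v(1) by (simp add: mult.assoc mult_left_mono)
  also have "\<dots> \<le> R' * R"
    using t(2)[of v] v(2) nonneg by (simp add: mult_right_mono)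
  finally have "R' * (t * R') \<le> R' * R"
    by (simp add: power2_eq_square mult_ac)
  then have "t * R' \<le> R"
    using nonneg t(1) by (cases "R' = 0") (auto simp: mult_le_cancel_left)
  then show ?thesis by (simp add: R_def R'_def)
qed

context network begin

section \<open>The trace as a limit of finite excursions\<close>

lemma laplacian_entry_off_diag:
  assumes "x \<in> V" "y \<in> V" "x \<noteq> y"
  shows "laplacian_entry V c x y = - c x y"
proof -
  have "laplacian V c (indicator {y}) x = (\<Sum>\<^sub>\<infinity>u\<in>{y}. - c x u)"
    unfolding laplacian_def using assms
    by (intro infsum_cong_neutral) (auto simp: indicator_def)
  then show ?thesis by (simp add: laplacian_entry_def)
qed

lemma mat_pow_limit:
  assumes F: "incseq F" "(\<Union>m. F m) = U" "\<And>m. finite (F m)" "U \<subseteq> V" and "x \<in> V"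
  shows "(\<lambda>m. PP (F m) n x y) \<longlonglongrightarrow> mat_pow U P n x y"
  using \<open>x \<in> V\<close>
proof (induction n arbitrary: x)
  case 0
  then show ?case by simp
next
  case (Suc n)
  have FV: "F m \<subseteq> V" for m using F by auto
  have "(\<lambda>m. \<Sum>z\<in>F m. P x z * PP (F m) n z y) \<longlonglongrightarrow> (\<Sum>\<^sub>\<infinity>z\<in>U. P x z * mat_pow U P n z y)"
  proof (rule monotone_convergence_sum(2)[OF F(1-3), where B = 1])
    fix m k z assume z: "z \<in> U"
    then have zV: "z \<in> V" using F by auto
    show "0 \<le> P x z * PP (F m) n z y"
      using zV Suc F(3) FV by (intro mult_nonneg_nonneg P_nonneg mat_pow_nonneg) auto
    show "(\<lambda>m. P x z * PP (F m) n z y) \<longlonglongrightarrow> P x z * mat_pow U P n z y"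
      using Suc.IH[OF zV] by (intro tendsto_intros)
    assume "m \<le> k"
    then show "P x z * PP (F m) n z y \<le> P x z * PP (F k) n z y"
      using zV Suc(2) F FV incseqD[OF F(1)] by (intro mult_left_mono mat_pow_mono P_nonneg) auto
  next
    have "(\<Sum>z\<in>F m. P x z * PP (F m) n z y) \<le> 1" for m
      using mat_pow_le_1[OF F(3) FV Suc(2), of m "Suc n" y] by (simp only: mat_pow_finite_Suc[OF F(3)])
    then show "\<forall>\<^sub>F m in sequentially. (\<Sum>z\<in>F m. P x z * PP (F m) n z y) \<le> 1"
      by simp
  qed
  then show ?case
    by (simp add: mat_prod_def F(3))
qed

text \<open>
  The set and the number of steps grow together, so that a single limit covers both the matrix powers
  and the Neumann series.
\<close>

lemma green_limit:
  assumes F: "incseq F" "(\<Union>m. F m) = V - H" "\<And>m. finite (F m)"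
    and H: "H \<subseteq> V" "H \<noteq> {}" and xy: "x \<in> V - H" "y \<in> V"
  shows "(\<lambda>m. green (F m) m x y) \<longlonglongrightarrow> (\<Sum>n. mat_pow (V - H) P n x y)"
proof -
  obtain K where K: "\<And>F N x. finite F \<Longrightarrow> F \<subseteq> V - H \<Longrightarrow> x \<in> F \<Longrightarrow> green F N x y \<le> K"
    using green_bounded[OF H xy(2)] by blast
  have FV: "F m \<subseteq> V" and FH: "F m \<subseteq> V - H" for m using F(2) by auto
  have x: "x \<in> V" using xy by auto
  have un: "(\<Union>m::nat. {..<m}) = UNIV"
    by (auto intro: lessI)
  have inc: "incseq (\<lambda>m::nat. {..<m})"
    by (auto simp: incseq_def)
  have nonneg: "0 \<le> PP (F m) n x y" for m n
    using x F(3) FV by (rule_tac mat_pow_nonneg) auto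
  have mono: "PP (F m) n x y \<le> PP (F k) n x y" if "m \<le> k" for m k n
    using x F(3) FV incseqD[OF F(1) that] by (rule_tac mat_pow_mono) auto
  have lim: "(\<lambda>m. PP (F m) n x y) \<longlonglongrightarrow> mat_pow (V - H) P n x y" for n
    using F x by (intro mat_pow_limit) auto
  have bd: "\<forall>\<^sub>F m in sequentially. (\<Sum>n<m. PP (F m) n x y) \<le> K"
    using eventually_in_incseq[OF F(1,2) xy(1)]
    by eventually_elim (use K[OF F(3) FH] in \<open>auto simp: green_def\<close>)
  note mc = monotone_convergence_sum[OF inc un finite_lessThan nonneg mono lim bd, simplified]
  have "(\<lambda>n. mat_pow (V - H) P n x y) sums (\<Sum>\<^sub>\<infinity>n. mat_pow (V - H) P n x y)"
    using mc(1) by (intro has_sum_imp_sums has_sum_infsum)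
  then have "(\<Sum>\<^sub>\<infinity>n. mat_pow (V - H) P n x y) = (\<Sum>n. mat_pow (V - H) P n x y)"
    by (rule sums_unique)
  then show ?thesis
    using mc(2) by (simp add: green_def)
qed

text \<open>
  The conductance that excursions from \<open>x\<close> to \<open>y\<close> through \<open>F\<close> contribute, if at most \<open>N\<close> vertices of \<open>F\<close>
  are visited, with repetition.
\<close>

definition excursion :: "'a set \<Rightarrow> nat \<Rightarrow> 'a \<Rightarrow> 'a \<Rightarrow> real" where
  "excursion F N x y = (\<Sum>z\<in>F. c x z * hit F N z y)"

text \<open>
  Unfolding the Schur complement gives \<open>c x y\<close> plus a double sum over the complement of \<open>H\<close>; the signs
  of the two off-diagonal blocks cancel.  Each sum is a monotone limit: the inner one is bounded as a
  probability, the outer one by the total conductance at \<open>x\<close>.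
\<close>

lemma trace_cond_limit:
  assumes F: "incseq F" "(\<Union>m. F m) = V - H" "\<And>m. finite (F m)"
    and H: "H \<subseteq> V" "H \<noteq> {}" and xy: "x \<in> H" "y \<in> H" "x \<noteq> y"
  shows "(\<lambda>m. c x y + excursion (F m) m x y) \<longlonglongrightarrow> trace_cond V c H x y"
proof -
  define g where "g z w = (\<Sum>n. mat_pow (V - H) P n z w)" for z w
  define h where "h z = (\<Sum>\<^sub>\<infinity>w\<in>V - H. g z w * P w y)" for z
  have FV: "F m \<subseteq> V" and FH: "F m \<subseteq> V - H" for m using F(2) by auto
  have xyV: "x \<in> V" "y \<in> V" using xy H by auto
  have h: "(\<lambda>m. hit (F m) m z y) \<longlonglongrightarrow> h z" if z: "z \<in> V - H" for z
    unfolding hit_def h_def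
  proof (rule monotone_convergence_sum(2)[OF F, where B = 1])
    fix m k w assume w: "w \<in> V - H"
    show "0 \<le> green (F m) m z w * P w y"
      using z w F(3) FV xyV by (intro mult_nonneg_nonneg green_nonneg P_nonneg) auto
    show "(\<lambda>m. green (F m) m z w * P w y) \<longlonglongrightarrow> g z w * P w y"
      unfolding g_def using green_limit[OF F H z] w by (intro tendsto_intros) auto
    assume "m \<le> k"
    then show "green (F m) m z w * P w y \<le> green (F k) k z w * P w y"
      using z w F(3) FV xyV incseqD[OF F(1)] by (intro mult_right_mono green_mono P_nonneg) auto
  next
    show "\<forall>\<^sub>F m in sequentially. (\<Sum>w\<in>F m. green (F m) m z w * P w y) \<le> 1"
      using eventually_in_incseq[OF F(1,2) z]
    proof eventually_elim
      case (elim m)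
      have "y \<in> V - F m" using xy FH[of m] xyV by auto
      then show ?case
        using hit_le_1[OF F(3) FV elim, of y m] by (simp add: hit_def)
    qed
  qed
  have "(\<lambda>m. excursion (F m) m x y) \<longlonglongrightarrow> (\<Sum>\<^sub>\<infinity>z\<in>V - H. c x z * h z)"
    unfolding excursion_def
  proof (rule monotone_convergence_sum(2)[OF F, where B = "C x"])
    fix m k z assume z: "z \<in> V - H"
    show "0 \<le> c x z * hit (F m) m z y"
      using z F(3) FV xyV by (intro mult_nonneg_nonneg hit_nonneg c_nonneg) auto
    show "(\<lambda>m. c x z * hit (F m) m z y) \<longlonglongrightarrow> c x z * h z"
      using h[OF z] by (intro tendsto_intros)
    assume "m \<le> k"
    then show "c x z * hit (F m) m z y \<le> c x z * hit (F k) k z y"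
      using z F(3) FV xyV incseqD[OF F(1)] by (intro mult_left_mono hit_mono c_nonneg) auto
  next
    have "(\<Sum>z\<in>F m. c x z * hit (F m) m z y) \<le> C x" for m
    proof -
      have "y \<in> V - F m" using xy FH[of m] xyV by auto
      then have "(\<Sum>z\<in>F m. c x z * hit (F m) m z y) \<le> (\<Sum>z\<in>F m. c x z * 1)"
        using FV[of m] F(3) xyV by (intro sum_mono mult_left_mono hit_le_1 c_nonneg) auto
      also have "\<dots> \<le> C x"
        using sum_c_le[OF xyV(1) F(3) FV] by simp
      finally show ?thesis .
    qed
    then show "\<forall>\<^sub>F m in sequentially. (\<Sum>z\<in>F m. c x z * hit (F m) m z y) \<le> C x"
      by simp
  qed
  moreover have "trace_cond V c H x y = c x y + (\<Sum>\<^sub>\<infinity>z\<in>V - H. c x z * h z)"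
  proof -
    have inner: "mat_prod (V - H) (D_inverse V c H) (laplacian_entry V c) z y = - h z" for z
    proof -
      have "mat_prod (V - H) (D_inverse V c H) (laplacian_entry V c) z y
          = (\<Sum>\<^sub>\<infinity>w\<in>V - H. - (g z w * P w y))"
        unfolding mat_prod_def
      proof (rule infsum_cong)
        fix w assume "w \<in> V - H"
        then have "laplacian_entry V c w y = - c w y"
          using xy xyV by (intro laplacian_entry_off_diag) auto
        then show "D_inverse V c H z w * laplacian_entry V c w y = - (g z w * P w y)"
          by (simp add: D_inverse_def g_def trans_prob_def)
      qed
      then show ?thesis by (simp add: infsum_uminus h_def)
    qed
    have "mat_prod (V - H) (laplacian_entry V c)
        (mat_prod (V - H) (D_inverse V c H) (laplacian_entry V c)) x y = (\<Sum>\<^sub>\<infinity>z\<in>V - H. c x z * h z)"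
      unfolding mat_prod_def[of "V - H" "laplacian_entry V c"] inner
    proof (rule infsum_cong)
      fix z assume "z \<in> V - H"
      then have "laplacian_entry V c x z = - c x z"
        using xy xyV by (intro laplacian_entry_off_diag) auto
      then show "laplacian_entry V c x z * - h z = c x z * h z" by simp
    qed
    then show ?thesis
      using xy xyV by (simp add: trace_cond_def laplacian_trace_def laplacian_entry_off_diag)
  qed
  ultimately show ?thesis
    by (simp add: tendsto_add)
qed

lemma excursion_nonneg:
  "finite F \<Longrightarrow> F \<subseteq> V \<Longrightarrow> x \<in> V \<Longrightarrow> y \<in> V \<Longrightarrow> 0 \<le> excursion F N x y"
  unfolding excursion_def by (intro sum_nonneg mult_nonneg_nonneg hit_nonneg c_nonneg) auto

text \<open>
  Reversing a path preserves its weight.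
\<close>

lemma excursion_commute:
  assumes "finite F" "F \<subseteq> V" "x \<in> V - F" "y \<in> V - F"
  shows "excursion F N x y = excursion F N y x"
proof -
  have pos: "0 < C z" if "z \<in> F" for z
    using C_pos[of z x] that assms by auto
  have ex: "excursion F N x y = (\<Sum>z\<in>F. \<Sum>w\<in>F. c x z * (green F N z w / C w) * c w y)" for x y
    unfolding excursion_def hit_def trans_prob_def by (simp add: sum_distrib_left mult.assoc)
  have "(\<Sum>z\<in>F. \<Sum>w\<in>F. c x z * (green F N z w / C w) * c w y) =
      (\<Sum>z\<in>F. \<Sum>w\<in>F. c y w * (green F N w z / C z) * c z x)"
  proof (intro sum.cong refl)
    fix z w assume zw: "z \<in> F" "w \<in> F"
    have "green F N z w / C w = green F N w z / C z"
      using green_reversible[OF assms(1,2) zw, of N] pos[OF zw(1)] pos[OF zw(2)] by (simp add: field_simps)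
    moreover have "c x z = c z x" "c w y = c y w"
      using zw assms by (auto intro: c_sym)
    ultimately show "c x z * (green F N z w / C w) * c w y = c y w * (green F N w z / C z) * c z x"
      by simp
  qed
  then show ?thesis
    unfolding ex by (subst (2) sum.swap)
qed

text \<open>
  Excursions of bounded length weigh less than all excursions through \<open>F\<close>, and for the latter
  \<open>energy_trace_le\<close> applies.
\<close>

lemma excursion_energy_le:
  assumes H: "finite H" "H \<subseteq> V" "H \<noteq> {}" and F: "finite F" "F \<subseteq> V - H"
  shows "energy H (\<lambda>x y. c x y + excursion F N x y) u \<le> energy (H \<union> F) c u"
proof -
  have FV: "F \<subseteq> V" using F by auto
  obtain \<pi> where \<pi>: "\<And>N z y. z \<in> F \<Longrightarrow> y \<in> H \<Longrightarrow> hit F N z y \<le> \<pi> z y"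
    "\<And>z y. z \<in> F \<Longrightarrow> y \<in> H \<Longrightarrow> 0 \<le> \<pi> z y"
    "\<And>z. z \<in> F \<Longrightarrow> (\<Sum>y\<in>H. \<pi> z y) \<le> 1"
    "\<And>z y. z \<in> F \<Longrightarrow> y \<in> H \<Longrightarrow> C z * \<pi> z y = c z y + (\<Sum>w\<in>F. c z w * \<pi> w y)"
    using hit_limit[OF F H(2,3,1)] by blast
  have "energy H (\<lambda>x y. c x y + excursion F N x y) u
      \<le> energy H (\<lambda>x y. c x y + (\<Sum>z\<in>F. c x z * \<pi> z y)) u"
    unfolding excursion_def using H FV \<pi>(1) c_nonneg
    by (intro energy_mono add_left_mono sum_mono mult_left_mono) (auto simp: subset_iff)
  also have "\<dots> \<le> energy (H \<union> F) c u"
  proof (rule energy_trace_le)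
    show "(\<Sum>w\<in>F. c z w) \<le> C z" if "z \<in> F" for z
      using that FV F(1) by (intro sum_c_le) auto
  qed (use H F FV \<pi>(2-4) in \<open>auto simp: subset_iff intro: c_nonneg c_sym\<close>)
  finally show ?thesis .
qed

section \<open>Free and trace resistance\<close>

lemma exhaustionD:
  assumes "exhaustion V c G"
  shows "finite (G k)" "connected_network (G k) c" "G k \<subseteq> V" "incseq G" "(\<Union>k. G k) = V" "resistance_network (G k) c"
proof -
  show *: "finite (G k)" "connected_network (G k) c" "G k \<subseteq> V" "incseq G" "(\<Union>k. G k) = V"
    using assms by (auto simp: exhaustion_def)
  show "resistance_network (G k) c"
    using * by (intro finite_subnetwork)
qed

lemma eff_resistance_subnetwork:
  assumes "finite W'" "W' \<subseteq> V" "connected_network W' c" "W \<subseteq> W'" "connected_network W c" "a \<in> W" "b \<in> W"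
  shows "eff_resistance W' c a b \<le> eff_resistance W c a b"
proof -
  have fin: "finite W" using assms finite_subset by blast
  have "1 * eff_resistance W' c a b \<le> eff_resistance W c a b"
  proof (rule Rayleigh_monotonicity)
    show "1 * energy W c u \<le> energy W' c u" for u
      using energy_mono_set[of W' W c u] assms c_nonneg by (auto simp: subset_iff)
  qed (use assms fin in \<open>auto intro!: finite_subnetwork\<close>)
  then show ?thesis by simp
qed

definition subnetworks :: "'a \<Rightarrow> 'a \<Rightarrow> 'a set set" where
  "subnetworks a b = {W. finite W \<and> W \<subseteq> V \<and> connected_network W c \<and> a \<in> W \<and> b \<in> W}"

definition inf_resistance :: "'a \<Rightarrow> 'a \<Rightarrow> real" where
  "inf_resistance a b = (INF W\<in>subnetworks a b. eff_resistance W c a b)"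

lemma subnetwork_resistance_nonneg:
  assumes "W \<in> subnetworks a b"
  shows "0 \<le> eff_resistance W c a b"
proof -
  interpret W: network W c
    using assms by unfold_locales (auto simp: subnetworks_def intro: finite_subnetwork)
  show ?thesis using assms by (intro W.eff_resistance_nonneg) (auto simp: subnetworks_def)
qed

lemma inf_resistance_le: "W \<in> subnetworks a b \<Longrightarrow> inf_resistance a b \<le> eff_resistance W c a b"
  unfolding inf_resistance_def using subnetwork_resistance_nonneg
  by (intro cINF_lower bdd_belowI2[where m = 0]) auto

text \<open>
  Along an exhaustion the resistances do not fall below the infimum, and once a nearly optimal
  subnetwork is contained in \<open>G k\<close> they stay close to it.
\<close>

lemma has_free_resistance_inf: "has_free_resistance V c a b (inf_resistance a b)"
  unfolding has_free_resistance_def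
proof (intro allI impI)
  fix G assume "exhaustion V c G \<and> (\<forall>k. a \<in> G k \<and> b \<in> G k)"
  then have ex: "exhaustion V c G" and ab: "\<And>k. a \<in> G k" "\<And>k. b \<in> G k" by auto
  note G = exhaustionD[OF ex]
  have Gsub: "G k \<in> subnetworks a b" for k
    using G ab by (simp add: subnetworks_def)
  have mono: "eff_resistance (G n) c a b \<le> eff_resistance W c a b" if "W \<in> subnetworks a b" "W \<subseteq> G n" for W n
    using that G ab by (intro eff_resistance_subnetwork) (auto simp: subnetworks_def)
  show "(\<lambda>k. eff_resistance (G k) c a b) \<longlonglongrightarrow> inf_resistance a b"
  proof (rule LIMSEQ_I)
    fix e :: real assume "e > 0"
    then have "inf_resistance a b < inf_resistance a b + e" by simp
    then obtain W where W: "W \<in> subnetworks a b" "eff_resistance W c a b < inf_resistance a b + e"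
      unfolding inf_resistance_def using Gsub subnetwork_resistance_nonneg
      by (subst (asm) cINF_less_iff) (auto intro!: bdd_belowI2[where m = 0])
    then have "finite W" "W \<subseteq> V" by (auto simp: subnetworks_def)
    then have "\<forall>\<^sub>F k in sequentially. \<forall>x\<in>W. x \<in> G k"
      using eventually_in_incseq[OF G(4,5)] by (intro eventually_ball_finite) auto
    then obtain M where M: "\<And>k. k \<ge> M \<Longrightarrow> W \<subseteq> G k"
      by (auto simp: eventually_sequentially)
    show "\<exists>no. \<forall>n\<ge>no. norm (eff_resistance (G n) c a b - inf_resistance a b) < e"
    proof (intro exI[of _ M] allI impI)
      fix n assume "n \<ge> M"
      then show "norm (eff_resistance (G n) c a b - inf_resistance a b) < e"
        using mono[OF W(1) M] W(2) inf_resistance_le[OF Gsub] by fastforce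
    qed
  qed
qed

lemma excursion_limit_at:
  assumes ex: "exhaustion V c G" and xy: "x \<in> G k" "y \<in> G k" "x \<noteq> y"
  shows "(\<lambda>m. c x y + excursion (G m - G k) m x y) \<longlonglongrightarrow> trace_cond V c (G k) x y"
proof (rule trace_cond_limit)
  note G = exhaustionD[OF ex]
  show "incseq (\<lambda>m. G m - G k)"
    using G(4) unfolding incseq_def by blast
  show "(\<Union>m. G m - G k) = V - G k" using G(5) by auto
qed (use exhaustionD[OF ex] xy in auto)

lemma trace_cond_ge:
  assumes ex: "exhaustion V c G" and xy: "x \<in> G k" "y \<in> G k"
  shows "c x y \<le> trace_cond V c (G k) x y"
proof (cases "x = y")
  case True
  then show ?thesis using c_diag[of x] exhaustionD(3)[OF ex, of k] xy by (auto simp: trace_cond_def)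
next
  case False
  note G = exhaustionD[OF ex]
  have "0 \<le> excursion (G m - G k) m x y" for m
    using G(1)[of m] G(3)[of m] G(3)[of k] xy by (intro excursion_nonneg) auto
  then show ?thesis
    by (intro LIMSEQ_le_const[OF excursion_limit_at[OF ex xy False]]) auto
qed

lemma trace_network:
  assumes ex: "exhaustion V c G"
  shows "resistance_network (G k) (trace_cond V c (G k))"
  unfolding resistance_network_def
proof (intro conjI ballI)
  note G = exhaustionD[OF ex]
  show "connected_network (G k) (trace_cond V c (G k))"
  proof -
    have "(edge_rel (G k) c)\<^sup>* \<subseteq> (edge_rel (G k) (trace_cond V c (G k)))\<^sup>*"
      using trace_cond_ge[OF ex] by (intro rtrancl_mono) (fastforce simp: edge_rel_def)
    then show ?thesis using G(2)[of k] unfolding connected_network_def by blast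
  qed
  fix x assume x: "x \<in> G k"
  show "trace_cond V c (G k) x x = 0" by (simp add: trace_cond_def)
  show "trace_cond V c (G k) x summable_on G k" using G(1) by simp
  fix y assume y: "y \<in> G k"
  have xyV: "x \<in> V" "y \<in> V" using x y G(3) by auto
  show "0 \<le> trace_cond V c (G k) x y"
    using trace_cond_ge[OF ex x y] c_nonneg[OF xyV] by linarith
  show "trace_cond V c (G k) x y = trace_cond V c (G k) y x"
  proof (cases "x = y")
    case False
    have "c x y + excursion (G m - G k) m x y = c y x + excursion (G m - G k) m y x" for m
      using x y xyV G(1)[of m] G(3)[of m] by (subst excursion_commute) (auto simp: c_sym)
    then show ?thesis
      using excursion_limit_at[OF ex x y False] excursion_limit_at[OF ex y x] False
        LIMSEQ_unique by force
  qed simp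
qed

lemma trace_resistance_le:
  assumes ex: "exhaustion V c G" and ab: "a \<in> G k" "b \<in> G k"
  shows "eff_resistance (G k) (trace_cond V c (G k)) a b \<le> eff_resistance (G k) c a b"
proof -
  note G = exhaustionD[OF ex]
  have "1 * eff_resistance (G k) (trace_cond V c (G k)) a b \<le> eff_resistance (G k) c a b"
  proof (rule Rayleigh_monotonicity)
    show "1 * energy (G k) c u \<le> energy (G k) (trace_cond V c (G k)) u" for u
      using trace_cond_ge[OF ex] by (simp add: energy_mono)
  qed (use G ab trace_network[OF ex] in auto)
  then show ?thesis by simp
qed

text \<open>
  For \<open>t < 1\<close> and large \<open>m\<close>, the conductances of \<open>G k\<close> together with the excursions through \<open>G m - G k\<close>
  are at least \<open>t\<close> times the trace conductances, as these are finitely many limits.  The energy of the trace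
  network is therefore at most \<open>1 / t\<close> times that of \<open>G m\<close>, and \<open>t\<close> is arbitrary.
\<close>

lemma trace_resistance_ge:
  assumes ex: "exhaustion V c G" and ab: "\<And>m. a \<in> G m" "\<And>m. b \<in> G m"
  shows "inf_resistance a b \<le> eff_resistance (G k) (trace_cond V c (G k)) a b"
proof -
  note G = exhaustionD[OF ex]
  let ?H = "G k" and ?tr = "trace_cond V c (G k)"
  have Gsub: "G m \<in> subnetworks a b" for m
    using G ab by (simp add: subnetworks_def)
  interpret tr: network ?H ?tr
    by unfold_locales (rule trace_network[OF ex])
  have "t * inf_resistance a b \<le> eff_resistance ?H ?tr a b" if t: "0 < t" "t < 1" for t
  proof -
    have "\<forall>\<^sub>F m in sequentially. \<forall>x\<in>?H. \<forall>y\<in>?H. x \<noteq> y \<longrightarrow> t * ?tr x y \<le> c x y + excursion (G m - ?H) m x y"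
    proof (intro eventually_ball_finite ballI G(1))
      fix x y assume xy: "x \<in> ?H" "y \<in> ?H"
      show "\<forall>\<^sub>F m in sequentially. x \<noteq> y \<longrightarrow> t * ?tr x y \<le> c x y + excursion (G m - ?H) m x y"
      proof (cases "x = y \<or> ?tr x y = 0")
        case True
        have "0 \<le> c x y + excursion (G m - ?H) m x y" for m
          using G(1)[of m] G(3)[of m] G(3)[of k] xy
          by (intro add_nonneg_nonneg c_nonneg excursion_nonneg) auto
        then show ?thesis using True by auto
      next
        case False
        then have "0 < ?tr x y" using tr.c_nonneg[OF xy] by simp
        then have "t * ?tr x y < ?tr x y" using t by simp
        then have "\<forall>\<^sub>F m in sequentially. t * ?tr x y < c x y + excursion (G m - ?H) m x y"
          using excursion_limit_at[OF ex xy] False by (auto intro: order_tendstoD)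
        then show ?thesis by eventually_elim auto
      qed
    qed
    then have "\<forall>\<^sub>F m in sequentially. k \<le> m \<and> (\<forall>x\<in>?H. \<forall>y\<in>?H. x \<noteq> y \<longrightarrow> t * ?tr x y \<le> c x y + excursion (G m - ?H) m x y)"
      using eventually_ge_at_top[of k] by eventually_elim simp
    then obtain m where m: "k \<le> m"
      "\<And>x y. x \<in> ?H \<Longrightarrow> y \<in> ?H \<Longrightarrow> x \<noteq> y \<Longrightarrow> t * ?tr x y \<le> c x y + excursion (G m - ?H) m x y"
      using eventually_happens'[OF sequentially_bot] by blast
    have un: "?H \<union> (G m - ?H) = G m"
      using incseqD[OF G(4) m(1)] by auto
    have "t * energy ?H ?tr u \<le> energy (G m) c u" for u
    proof -
      have "t * energy ?H ?tr u = energy ?H (\<lambda>x y. t * ?tr x y) u"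
        by (rule energy_scale [symmetric])
      also have "\<dots> \<le> energy ?H (\<lambda>x y. c x y + excursion (G m - ?H) m x y) u"
        using m(2) by (rule energy_mono)
      also have "\<dots> \<le> energy (?H \<union> (G m - ?H)) c u"
        using G(1,3) ab(1)[of k] by (intro excursion_energy_le) auto
      finally show ?thesis by (simp only: un)
    qed
    then have "t * eff_resistance (G m) c a b \<le> eff_resistance ?H ?tr a b"
      using G ab t trace_network[OF ex] by (intro Rayleigh_monotonicity) auto
    moreover have "t * inf_resistance a b \<le> t * eff_resistance (G m) c a b"
      using inf_resistance_le[OF Gsub] t by simp
    ultimately show ?thesis by linarith
  qed
  then show ?thesis by (rule field_le_mult_one_interval)
qed

lemma has_trace_resistance_inf: "has_trace_resistance V c a b (inf_resistance a b)"
  unfolding has_trace_resistance_def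
proof (intro allI impI)
  fix G assume G: "exhaustion V c G \<and> (\<forall>k. a \<in> G k \<and> b \<in> G k)"
  show "(\<lambda>k. eff_resistance (G k) (trace_cond V c (G k)) a b) \<longlonglongrightarrow> inf_resistance a b"
  proof (rule tendsto_sandwich)
    show "\<forall>\<^sub>F k in sequentially. inf_resistance a b \<le> eff_resistance (G k) (trace_cond V c (G k)) a b"
      using G by (intro always_eventually allI trace_resistance_ge) auto
    show "\<forall>\<^sub>F k in sequentially. eff_resistance (G k) (trace_cond V c (G k)) a b \<le> eff_resistance (G k) c a b"
      using G by (intro always_eventually allI trace_resistance_le) auto
    show "(\<lambda>k. eff_resistance (G k) c a b) \<longlonglongrightarrow> inf_resistance a b"
      using has_free_resistance_inf G unfolding has_free_resistance_def by blast
  qed simp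
qed

end

theorem corollary3p15:
  fixes V :: "'a set" and c :: "'a \<Rightarrow> 'a \<Rightarrow> real"
  assumes "resistance_network V c"
    and "transient_network V c"
    and "a \<in> V" and "b \<in> V"
  shows "has_free_resistance V c a b (free_resistance V c a b) \<and>
         has_trace_resistance V c a b (trace_resistance V c a b) \<and>
         trace_resistance V c a b = free_resistance V c a b"
proof -
  interpret network V c by unfold_locales (rule assms)
  obtain G where G: "exhaustion V c G" "\<And>k. a \<in> G k \<and> b \<in> G k"
    using exhaustion_exists[OF assms(3,4)] by blast
  have "R = R'" if "has_free_resistance V c a b R" "has_free_resistance V c a b R'" for R R'
    using that G LIMSEQ_unique unfolding has_free_resistance_def by blast
  then have "free_resistance V c a b = inf_resistance a b"
    unfolding free_resistance_def using has_free_resistance_inf by (intro the_equality) auto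
  moreover have "R = R'" if "has_trace_resistance V c a b R" "has_trace_resistance V c a b R'" for R R'
    using that G LIMSEQ_unique unfolding has_trace_resistance_def by blast
  then have "trace_resistance V c a b = inf_resistance a b"
    unfolding trace_resistance_def using has_trace_resistance_inf by (intro the_equality) auto
  ultimately show ?thesis
    using has_free_resistance_inf has_trace_resistance_inf by simp
qed

end
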